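(* Let $s,t$ be coprime integers greater than $1$, let $\sigma$ be an $s$-core, $\tau$ a $t$-core and $n\ge0$. The following are equivalent: (1) $|\mathcal P_{\sigma,\tau}(n)|=1$; (2) $\mathrm{cor}_t(\sigma)=\mathrm{cor}_s(\tau)$ and $n=|\sigma|+|\tau|-|\mathrm{cor}_t(\sigma)|$; (3) $n=m_{\sigma,\tau}=|\tau|+t\,\mathrm{wei}_t(\sigma)$; (4) $n=m_{\sigma,\tau}=|\sigma|+s\,\mathrm{wei}_s(\tau)$.
   Context: Partitions, size $|\lambda|$. A rim $s$-hook is a connected set of $s$ nodes of the rim of the Young diagram (nodes $(r,c)$ with $(r+1,c+1)$ not a node) whose removal leaves a partition's diagram; $\lambda$ is an $s$-core if it has no rim $s$-hook. The $s$-core $\mathrm{cor}_s(\lambda)$ is obtained by repeatedly removing rim $s$-hooks, and the $s$-weight $\mathrm{wei}_s(\lambda)$ is the number removed. $\mathcal P_{\sigma,\tau}(n)$ is the set of partitions of $n$ with $s$-core $\sigma$ and $t$-core $\tau$. $m_{\sigma,\tau}$ denotes the smallest $n$ for which $\mathcal P_{\sigma,\tau}(n)\neq\emptyset$. *)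

theory Defs
  imports Main
begin

text \<open>Partitions are weakly decreasing sequences of natural numbers with finite sum; rows and
  columns are indexed from 0.\<close>

definition is_partition :: "(nat \<Rightarrow> nat) \<Rightarrow> bool" where
  "is_partition p \<longleftrightarrow> antimono p \<and> finite {i. p i \<noteq> 0}"

definition psize :: "(nat \<Rightarrow> nat) \<Rightarrow> nat" where
  "psize p = (\<Sum>i | p i \<noteq> 0. p i)"

definition young_diagram :: "(nat \<Rightarrow> nat) \<Rightarrow> (nat \<times> nat) set" where
  "young_diagram p = {(r, c). c < p r}"

definition rim :: "(nat \<Rightarrow> nat) \<Rightarrow> (nat \<times> nat) set" where
  "rim p = {(r, c). (r, c) \<in> young_diagram p \<and> (r + 1, c + 1) \<notin> young_diagram p}"

definition adjacent_nodes :: "nat \<times> nat \<Rightarrow> nat \<times> nat \<Rightarrow> bool" where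
  "adjacent_nodes x y \<longleftrightarrow>
     (fst x = fst y \<and> (snd y = snd x + 1 \<or> snd x = snd y + 1)) \<or>
     (snd x = snd y \<and> (fst y = fst x + 1 \<or> fst x = fst y + 1))"

definition connected_nodes :: "(nat \<times> nat) set \<Rightarrow> bool" where
  "connected_nodes H \<longleftrightarrow>
     (\<forall>x\<in>H. \<forall>y\<in>H. (\<lambda>a b. a \<in> H \<and> b \<in> H \<and> adjacent_nodes a b)\<^sup>*\<^sup>* x y)"

definition rim_hook :: "nat \<Rightarrow> (nat \<Rightarrow> nat) \<Rightarrow> (nat \<times> nat) set \<Rightarrow> bool" where
  "rim_hook s p H \<longleftrightarrow>
     H \<subseteq> rim p \<and> connected_nodes H \<and> card H = s \<and>
     (\<exists>q. is_partition q \<and> young_diagram q = young_diagram p - H)"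

definition is_core :: "nat \<Rightarrow> (nat \<Rightarrow> nat) \<Rightarrow> bool" where
  "is_core s p \<longleftrightarrow> is_partition p \<and> (\<nexists>H. rim_hook s p H)"

definition removes_hook :: "nat \<Rightarrow> (nat \<Rightarrow> nat) \<Rightarrow> (nat \<Rightarrow> nat) \<Rightarrow> bool" where
  "removes_hook s p q \<longleftrightarrow>
     (\<exists>H. rim_hook s p H \<and> is_partition q \<and> young_diagram q = young_diagram p - H)"

text \<open>For a partition and \<open>s \<ge> 1\<close>, the core reached and the number of hooks removed do not depend
  on the choices made during the removal process, so the descriptions below are proper.\<close>

definition cor :: "nat \<Rightarrow> (nat \<Rightarrow> nat) \<Rightarrow> (nat \<Rightarrow> nat)" where
  "cor s p = (THE q. (removes_hook s)\<^sup>*\<^sup>* p q \<and> is_core s q)"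

definition wei :: "nat \<Rightarrow> (nat \<Rightarrow> nat) \<Rightarrow> nat" where
  "wei s p = (THE w. \<exists>q. (removes_hook s ^^ w) p q \<and> is_core s q)"

definition core_partitions ::
    "nat \<Rightarrow> nat \<Rightarrow> (nat \<Rightarrow> nat) \<Rightarrow> (nat \<Rightarrow> nat) \<Rightarrow> nat \<Rightarrow> (nat \<Rightarrow> nat) set" where
  "core_partitions s t \<sigma> \<tau> n =
     {p. is_partition p \<and> psize p = n \<and> cor s p = \<sigma> \<and> cor t p = \<tau>}"

definition min_size :: "nat \<Rightarrow> nat \<Rightarrow> (nat \<Rightarrow> nat) \<Rightarrow> (nat \<Rightarrow> nat) \<Rightarrow> nat" where
  "min_size s t \<sigma> \<tau> = (LEAST n. core_partitions s t \<sigma> \<tau> n \<noteq> {})"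

end

theory Submission
  imports Defs
begin

text \<open>
  Encode a partition by its beta-set, a set \<open>B\<close> of integers containing all sufficiently small
  and no sufficiently large integers. Removing a rim \<open>d\<close>-hook moves a bead from \<open>x\<close> to
  \<open>x - d\<close>, so the \<open>d\<close>-core is determined by the charges of the residue classes modulo
  \<open>d\<close>, and the \<open>d\<close>-weight is the number of pairs of a bead \<open>x\<close> and a gap
  \<open>y < x\<close> with \<open>d\<close> dividing \<open>x - y\<close>. Counting these pairs along the \<open>s\<close>-runners
  shows that passing to the \<open>s\<close>-core does not increase the \<open>t\<close>-weight, and that the weight is kept
  precisely when \<open>B\<close> has no checkerboard pattern \<open>x \<in> B\<close>, \<open>x + ms \<notin> B\<close>,
  \<open>x + kt \<notin> B\<close>, \<open>x + ms + kt \<in> B\<close>. This condition is symmetric in \<open>s\<close> and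
  \<open>t\<close>, and each of the four statements says that some partition of \<open>n\<close> with the given cores has
  no checkerboard: such configurations are determined by their charges, exist exactly when the cores of the cores agree,
  and are the only ones that admit no exchange of beads and gaps preserving the size and both cores.
\<close>

section \<open>Charges of bead configurations\<close>

definition maya :: "int set \<Rightarrow> bool" where
  "maya S \<longleftrightarrow> finite (S \<inter> {0..}) \<and> finite ({..<0} - S)"

definition charge :: "int set \<Rightarrow> int" where
  "charge S = int (card (S \<inter> {0..})) - int (card ({..<0} - S))"

lemma maya_bounds:
  assumes "maya S"
  obtains N where "0 \<le> N" "{..<-N} \<subseteq> S" "S \<subseteq> {..<N}"
proof -
  let ?X = "(S \<inter> {0..}) \<union> ({..<0} - S)"
  have fin: "finite ?X" using assms by (auto simp: maya_def)
  obtain N where N: "\<forall>x\<in>abs ` ?X. x \<le> N"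
    using fin by (metis finite_imageI finite_has_maximal2 bdd_above_finite bdd_above_def)
  have "0 \<le> max 0 N + 1" by simp
  moreover have "{..<-(max 0 N + 1)} \<subseteq> S"
  proof
    fix x assume "x \<in> {..<-(max 0 N + 1)}"
    then show "x \<in> S" using N by (cases "x \<in> S") force+
  qed
  moreover have "S \<subseteq> {..<max 0 N + 1}"
  proof
    fix x assume "x \<in> S"
    then show "x \<in> {..<max 0 N + 1}" using N by (cases "x \<ge> 0") force+
  qed
  ultimately show ?thesis using that by blast
qed

lemma maya_from_bounds:
  assumes "{..<-N} \<subseteq> S" "S \<subseteq> {..<N}"
  shows "maya S"
proof -
  have "S \<inter> {0..} \<subseteq> {0..<N}" "{..<0} - S \<subseteq> {-N..<0}" using assms by force+
  then show ?thesis unfolding maya_def by (meson finite_atLeastLessThan_int finite_subset)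
qed

lemma maya_Diff_finite:
  assumes "maya S" "maya T"
  shows "finite (S - T)"
proof -
  have "S - T \<subseteq> (S \<inter> {0..}) \<union> ({..<0} - T)" by auto
  then show ?thesis using assms unfolding maya_def by (meson finite_UnI finite_subset)
qed

lemma maya_finite_change:
  assumes "maya S" "finite (S - T)" "finite (T - S)"
  shows "maya T"
proof -
  have "T \<inter> {0..} \<subseteq> (S \<inter> {0..}) \<union> (T - S)" "{..<0} - T \<subseteq> ({..<0} - S) \<union> (S - T)" by auto
  then show ?thesis using assms unfolding maya_def by (meson finite_UnI finite_subset)
qed

lemma card_diff_card:
  assumes "finite A" "finite B"
  shows "int (card A) - int (card B) = int (card (A - B)) - int (card (B - A))"
proof -
  have "card A = card (A \<inter> B) + card (A - B)" "card B = card (A \<inter> B) + card (B - A)"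
    using card_Int_Diff[OF assms(1), of B] card_Int_Diff[OF assms(2), of A] by (simp_all add: Int_commute)
  then show ?thesis by simp
qed

lemma charge_diff:
  assumes "maya S" "maya T"
  shows "charge S - charge T = int (card (S - T)) - int (card (T - S))"
proof -
  let ?P = "\<lambda>S::int set. S \<inter> {0..}" and ?M = "\<lambda>S::int set. {..<0} - S"
  have split: "int (card (S - T)) = int (card (?P S - ?P T)) + int (card (?M T - ?M S))"
    if "maya S" "maya T" for S T
  proof -
    have "S - T = (?P S - ?P T) \<union> (?M T - ?M S)" by auto
    moreover have "finite (?P S - ?P T)" "finite (?M T - ?M S)"
      using that by (auto simp: maya_def)
    moreover have "(?P S - ?P T) \<inter> (?M T - ?M S) = {}" by auto
    ultimately show ?thesis by (metis card_Un_disjoint of_nat_add)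
  qed
  have "int (card (?P S)) - int (card (?P T)) = int (card (?P S - ?P T)) - int (card (?P T - ?P S))"
    "int (card (?M S)) - int (card (?M T)) = int (card (?M S - ?M T)) - int (card (?M T - ?M S))"
    using assms by (auto intro!: card_diff_card simp: maya_def)
  then show ?thesis using split[OF assms] split[OF assms(2,1)] by (simp add: charge_def)
qed

lemma charge_mono:
  assumes "maya S" "maya T" "S \<subseteq> T"
  shows "charge S \<le> charge T"
proof -
  have "card (S - T) = 0" using assms(3) by (metis Diff_eq_empty_iff card.empty)
  then show ?thesis using charge_diff[OF assms(1,2)] by linarith
qed

lemma charge_strict_mono:
  assumes "maya S" "maya T" "S \<subset> T"
  shows "charge S < charge T"
proof -
  have "card (S - T) = 0" using assms(3) by (metis Diff_eq_empty_iff card.empty psubset_imp_subset)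
  moreover have "card (T - S) > 0"
    using assms maya_Diff_finite[of T S] by (auto simp: card_gt_0_iff)
  ultimately show ?thesis using charge_diff[OF assms(1,2)] by linarith
qed

lemma maya_lessThan: "maya {..<N}" for N :: int
  by (rule maya_from_bounds[of "\<bar>N\<bar>"]) auto

lemma charge_lessThan: "charge {..<N} = N" for N :: int
proof (cases "0 \<le> N")
  case True
  then have "{..<N} \<inter> {0..} = {0..<N}" "{..<0} - {..<N} = {}" by auto
  then show ?thesis using True by (simp only: charge_def) simp
next
  case False
  then have "{..<N} \<inter> {0..} = {}" "{..<0} - {..<N} = {N..<0}" by auto
  then show ?thesis using False by (simp only: charge_def) simp
qed

lemma charge_cut:
  assumes "maya S"
  shows "charge S = N + int (card (S \<inter> {N..})) - int (card ({..<N} - S))"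
proof -
  have "S - {..<N} = S \<inter> {N..}" by auto
  then show ?thesis using charge_diff[OF assms maya_lessThan, of N] by (simp add: charge_lessThan)
qed

lemma maya_shift:
  assumes "maya S"
  shows "maya {k. k + m \<in> S}"
proof -
  obtain N where N: "{..<-N} \<subseteq> S" "S \<subseteq> {..<N}" using maya_bounds[OF assms] by metis
  show ?thesis
  proof (rule maya_from_bounds[of "N + \<bar>m\<bar>"])
    show "{..<- (N + \<bar>m\<bar>)} \<subseteq> {k. k + m \<in> S}"
      using N(1) by (auto simp: subset_eq abs_if split: if_splits)
    show "{k. k + m \<in> S} \<subseteq> {..<N + \<bar>m\<bar>}" using N(2) by force
  qed
qed

lemma charge_shift:
  assumes "maya S"
  shows "charge {k. k + m \<in> S} = charge S - m"
proof -
  have "bij_betw (\<lambda>k. k + m) ({k. k + m \<in> S} \<inter> {0..}) (S \<inter> {m..})"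
    by (rule bij_betw_byWitness[where f' = "\<lambda>k. k - m"]) auto
  moreover have "bij_betw (\<lambda>k. k + m) ({..<0} - {k. k + m \<in> S}) ({..<m} - S)"
    by (rule bij_betw_byWitness[where f' = "\<lambda>k. k - m"]) auto
  ultimately have "charge {k. k + m \<in> S} = int (card (S \<inter> {m..})) - int (card ({..<m} - S))"
    unfolding charge_def using bij_betw_same_card by metis
  then show ?thesis using charge_cut[OF assms, of m] by simp
qed

lemma maya_move:
  assumes "maya S"
  shows "maya (insert y (S - {x}))"
  by (rule maya_finite_change[OF assms]) (auto intro: finite_subset[of _ "{x,y}"])

lemma charge_move:
  assumes "maya S" "x \<in> S" "y \<notin> S"
  shows "charge (insert y (S - {x})) = charge S"
proof -
  have "S - insert y (S - {x}) = {x}" "insert y (S - {x}) - S = {y}" using assms by auto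
  then show ?thesis using charge_diff[OF assms(1) maya_move[OF assms(1)], of y x] by simp
qed

definition runner :: "int \<Rightarrow> int set \<Rightarrow> int \<Rightarrow> int set" where
  "runner d B x = {k. x + k * d \<in> B}"

definition rcharge :: "int \<Rightarrow> int set \<Rightarrow> int \<Rightarrow> int" where
  "rcharge d B x = charge (runner d B x)"

lemma maya_runner:
  assumes "maya B" "0 < d"
  shows "maya (runner d B x)"
proof -
  obtain N where N: "0 \<le> N" "{..<-N} \<subseteq> B" "B \<subseteq> {..<N}" using maya_bounds[OF assms(1)] by metis
  have grow: "k \<le> k * d" if "k \<ge> 0" for k
    using that assms(2) mult_left_mono[of 1 d k] by simp
  show ?thesis
  proof (rule maya_from_bounds[of "N + \<bar>x\<bar>"])
    show "{..<- (N + \<bar>x\<bar>)} \<subseteq> runner d B x"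
    proof
      fix k assume k: "k \<in> {..<- (N + \<bar>x\<bar>)}"
      then have "-k \<le> - k * d" using grow[of "-k"] N(1) by simp
      then have "x + k * d \<in> {..<-N}" using k by simp
      then show "k \<in> runner d B x" using N(2) by (auto simp: runner_def)
    qed
    show "runner d B x \<subseteq> {..<N + \<bar>x\<bar>}"
    proof
      fix k assume k: "k \<in> runner d B x"
      then have "x + k * d < N" using N(3) by (auto simp: runner_def)
      then show "k \<in> {..<N + \<bar>x\<bar>}" using grow[of k] N(1) by (cases "k \<ge> 0") auto
    qed
  qed
qed

lemma runner_shift: "runner d B (x + m * d) = {k. k + m \<in> runner d B x}"
  by (auto simp: runner_def algebra_simps)

lemma rcharge_shift:
  assumes "maya B" "0 < d"
  shows "rcharge d B (x + m * d) = rcharge d B x - m"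
  unfolding rcharge_def runner_shift by (rule charge_shift[OF maya_runner[OF assms]])

lemma rcharge_remove:
  assumes "maya B" "0 < d" "x \<in> B"
  shows "rcharge d (B - {x}) z = rcharge d B z - (if d dvd x - z then 1 else 0)"
proof (cases "d dvd x - z")
  case True
  then obtain a where a: "x = z + a * d" by (metis add.commute diff_add_cancel dvdE mult.commute)
  let ?R = "runner d B z"
  have "runner d (B - {x}) z = ?R - {a}" using assms(2) a by (auto simp: runner_def)
  moreover have "maya ?R" using maya_runner assms by blast
  moreover have "?R - (?R - {a}) = {a}" "?R - {a} - ?R = {}" using assms(3) a by (auto simp: runner_def)
  moreover have "maya (?R - {a})" by (rule maya_finite_change[OF \<open>maya ?R\<close>]) (auto intro: finite_subset[of _ "{a}"])
  ultimately have "charge ?R - charge (?R - {a}) = int (card {a}) - int (card ({} :: int set))"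
    using charge_diff[of ?R "?R - {a}"] by metis
  then have "charge ?R - charge (?R - {a}) = 1" by simp
  then show ?thesis using True \<open>runner d (B - {x}) z = ?R - {a}\<close> by (simp add: rcharge_def)
next
  case False
  then have "runner d (B - {x}) z = runner d B z" by (auto simp: runner_def)
  then show ?thesis using False by (simp add: rcharge_def)
qed

lemma rcharge_move:
  assumes "maya B" "0 < d" "x \<in> B" "y \<notin> B"
  shows "rcharge d (insert y (B - {x})) z
    = rcharge d B z - (if d dvd x - z then 1 else 0) + (if d dvd y - z then 1 else 0)"
proof -
  have m: "maya (insert y (B - {x}))" using maya_move[OF assms(1)] .
  have "insert y (B - {x}) - {y} = B - {x}" using assms(4) by auto
  then show ?thesis
    using rcharge_remove[OF m assms(2), of y z] rcharge_remove[OF assms(1-3), of z] by simp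
qed

lemma rcharge_move_runner:
  assumes "maya B" "0 < d" "x \<in> B" "y \<notin> B" "d dvd y - x"
  shows "rcharge d (insert y (B - {x})) = rcharge d B"
proof
  fix z
  have "y - z = (x - z) + (y - x)" by simp
  then have "d dvd y - z \<longleftrightarrow> d dvd x - z" using assms(5) by (metis dvd_add_left_iff)
  then show "rcharge d (insert y (B - {x})) z = rcharge d B z" using rcharge_move[OF assms(1-4)] by simp
qed

lemma card_eq_sum_residues:
  fixes X :: "int set"
  assumes "finite X" "0 < d"
  shows "card X = (\<Sum>i\<in>{0..<d}. card (runner d X i))"
proof -
  have "bij_betw (\<lambda>(i,k). i + k * d) (SIGMA i:{0..<d}. runner d X i) X"
    using assms(2)
    by (intro bij_betw_byWitness[where f' = "\<lambda>x. (x mod d, x div d)"]) (auto simp: runner_def)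
  then have "card X = card (SIGMA i:{0..<d}. runner d X i)" using bij_betw_same_card by metis
  moreover have "finite (runner d X i)" for i
  proof -
    have "runner d X i = (\<lambda>k. i + k * d) -` X" by (auto simp: runner_def)
    moreover have "inj (\<lambda>k. i + k * d)" using assms(2) by (auto simp: inj_def)
    ultimately show ?thesis using assms(1) finite_vimageI by metis
  qed
  ultimately show ?thesis by simp
qed

lemma charge_diff_residues:
  assumes "maya B" "maya C" "0 < d"
  shows "charge B - charge C = (\<Sum>i\<in>{0..<d}. rcharge d B i - rcharge d C i)"
proof -
  have r: "runner d (X - Y) i = runner d X i - runner d Y i" for X Y i by (auto simp: runner_def)
  have "rcharge d B i - rcharge d C i = int (card (runner d (B - C) i)) - int (card (runner d (C - B) i))" for i
    unfolding rcharge_def r using charge_diff maya_runner assms by simp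
  then have "(\<Sum>i\<in>{0..<d}. rcharge d B i - rcharge d C i) = int (card (B - C)) - int (card (C - B))"
    using card_eq_sum_residues[OF maya_Diff_finite[OF assms(1,2)] assms(3)]
      card_eq_sum_residues[OF maya_Diff_finite[OF assms(2,1)] assms(3)]
    by (simp add: sum_subtractf)
  then show ?thesis using charge_diff assms by simp
qed

lemma maya_from_runners:
  assumes "\<And>i. maya (runner d B i)" "0 < d"
  shows "maya B"
proof -
  let ?f = "\<lambda>i k. i + k * d"
  have fin: "finite (\<Union>i\<in>{0..<d}. ?f i ` (runner d B i \<inter> {0..}))"
    "finite (\<Union>i\<in>{0..<d}. ?f i ` ({..<0} - runner d B i))"
    using assms(1) by (auto simp: maya_def)
  have x: "x = ?f (x mod d) (x div d)" "x mod d \<in> {0..<d}" for x using assms(2) by auto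
  have "B \<inter> {0..} \<subseteq> (\<Union>i\<in>{0..<d}. ?f i ` (runner d B i \<inter> {0..}))"
  proof
    fix y assume y: "y \<in> B \<inter> {0..}"
    then have "y div d \<in> runner d B (y mod d) \<inter> {0..}"
      using assms(2) by (auto simp: runner_def pos_imp_zdiv_nonneg_iff)
    then show "y \<in> (\<Union>i\<in>{0..<d}. ?f i ` (runner d B i \<inter> {0..}))" using x[of y] by blast
  qed
  moreover have "{..<0} - B \<subseteq> (\<Union>i\<in>{0..<d}. ?f i ` ({..<0} - runner d B i))"
  proof
    fix y assume y: "y \<in> {..<0} - B"
    then have "y div d \<in> {..<0} - runner d B (y mod d)"
      using assms(2) by (auto simp: runner_def div_neg_pos_less0)
    then show "y \<in> (\<Union>i\<in>{0..<d}. ?f i ` ({..<0} - runner d B i))" using x[of y] by blast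
  qed
  ultimately show ?thesis using fin unfolding maya_def by (meson finite_subset)
qed

definition bead_core :: "int \<Rightarrow> int set \<Rightarrow> bool" where
  "bead_core d B \<longleftrightarrow> (\<forall>x\<in>B. x - d \<in> B)"

lemma bead_core_mult:
  assumes "bead_core d B" "x \<in> B"
  shows "x - int k * d \<in> B"
proof (induction k)
  case 0 then show ?case using assms by simp
next
  case (Suc k)
  then have "x - int k * d - d \<in> B" using assms(1) by (simp add: bead_core_def)
  then show ?case by (simp add: algebra_simps)
qed

lemma bead_core_iff:
  assumes "maya B" "0 < d" "bead_core d B"
  shows "x \<in> B \<longleftrightarrow> 0 < rcharge d B x"
proof
  assume x: "x \<in> B"
  have "k \<in> runner d B x" if "k < 1" for k
    using bead_core_mult[OF assms(3) x, of "nat (-k)"] that by (simp add: runner_def)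
  then have "{..<1} \<subseteq> runner d B x" by auto
  then show "0 < rcharge d B x"
    using charge_mono[OF maya_lessThan maya_runner[OF assms(1,2)], of 1 x] by (simp add: charge_lessThan rcharge_def)
next
  assume pos: "0 < rcharge d B x"
  show "x \<in> B"
  proof (rule ccontr)
    assume x: "x \<notin> B"
    have "runner d B x \<subseteq> {..<0}"
    proof
      fix k assume k: "k \<in> runner d B x"
      show "k \<in> {..<0}"
        using bead_core_mult[OF assms(3), of "x + k * d" "nat k"] k x by (auto simp: runner_def split: if_splits)
    qed
    then show False using charge_mono[OF maya_runner[OF assms(1,2)] maya_lessThan, of x 0] pos
      by (simp add: charge_lessThan rcharge_def)
  qed
qed

section \<open>Inversions and nested configurations\<close>

definition inversions :: "int \<Rightarrow> int set \<Rightarrow> (int \<times> int) set" where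
  "inversions d B = {(x, y). x \<in> B \<and> y \<notin> B \<and> y < x \<and> d dvd x - y}"

lemma finite_inversions:
  assumes "maya B"
  shows "finite (inversions d B)"
proof -
  obtain N where N: "{..<-N} \<subseteq> B" "B \<subseteq> {..<N}" using maya_bounds[OF assms] by metis
  have "inversions d B \<subseteq> {-N..<N} \<times> {-N..<N}"
    using N by (fastforce simp: inversions_def subset_eq not_le)
  then show ?thesis by (rule finite_subset) auto
qed

lemma card_inversions_move:
  assumes "maya B" "0 < d" "x \<in> B" "x - d \<notin> B"
  shows "card (inversions d B) = Suc (card (inversions d (insert (x - d) (B - {x}))))"
proof -
  let ?B' = "insert (x - d) (B - {x})"
  let ?f = "\<lambda>u. if u = x then x - d else if u = x - d then x else u"
  have gap: "v < x - d" if "d dvd x - v" "v < x" "v \<noteq> x - d" for v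
  proof -
    obtain k where k: "x - v = d * k" using \<open>d dvd x - v\<close> by blast
    then have "0 < d * k" "k \<noteq> 1" using that by auto
    then have "2 \<le> k" using assms(2) by (simp add: zero_less_mult_iff)
    then have "d * 2 \<le> d * k" using assms(2) by simp
    then show ?thesis using k assms(2) by linarith
  qed
  have gap': "x < u" if "d dvd u - (x - d)" "x - d < u" "u \<noteq> x" for u
  proof -
    obtain k where k: "u - (x - d) = d * k" using \<open>d dvd u - (x - d)\<close> by blast
    then have "0 < d * k" "k \<noteq> 1" using that by auto
    then have "2 \<le> k" using assms(2) by (simp add: zero_less_mult_iff)
    then have "d * 2 \<le> d * k" using assms(2) by simp
    then show ?thesis using k assms(2) by linarith
  qed
  have sh: "d dvd x - d - v \<longleftrightarrow> d dvd x - v" "d dvd v - (x - d) \<longleftrightarrow> d dvd v - x" for v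
  proof -
    have "x - d - v = (x - v) - d" "v - (x - d) = (v - x) + d" by simp_all
    then show "d dvd x - d - v \<longleftrightarrow> d dvd x - v" "d dvd v - (x - d) \<longleftrightarrow> d dvd v - x"
      by (simp_all only: dvd_add_left_iff[OF dvd_refl] dvd_diff_left_iff[OF dvd_refl])
  qed
  have fwd: "map_prod ?f ?f p \<in> inversions d ?B'" if p: "p \<in> inversions d B - {(x, x - d)}" for p
  proof -
    obtain u v where uv: "p = (u, v)" by fastforce
    have h: "u \<in> B" "v \<notin> B" "v < u" "d dvd u - v" "\<not> (u = x \<and> v = x - d)"
      using p by (auto simp: uv inversions_def)
    have ne: "u \<noteq> x - d" "v \<noteq> x" using h assms by auto
    consider "u = x" "v \<noteq> x - d" | "u \<noteq> x" "v = x - d" | "u \<noteq> x" "v \<noteq> x - d" using h by blast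
    then show ?thesis
    proof cases
      case 1
      then show ?thesis using h ne gap[of v] assms by (simp add: uv inversions_def sh)
    next
      case 2
      then show ?thesis using h ne gap'[of u] assms by (simp add: uv inversions_def sh)
    next
      case 3
      then show ?thesis using h ne assms by (simp add: uv inversions_def)
    qed
  qed
  have bwd: "map_prod ?f ?f p \<in> inversions d B - {(x, x - d)}" if p: "p \<in> inversions d ?B'" for p
  proof -
    obtain u v where uv: "p = (u, v)" by fastforce
    have h: "u \<in> ?B'" "v \<notin> ?B'" "v < u" "d dvd u - v"
      using p by (auto simp: uv inversions_def)
    have ne: "u \<noteq> x" "v \<noteq> x - d" using h assms by auto
    consider "u = x - d" "v \<noteq> x" | "u \<noteq> x - d" "v = x" | "u \<noteq> x - d" "v \<noteq> x"
      using h assms(2) by force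
    then show ?thesis
    proof cases
      case 1
      then show ?thesis using h ne assms by (simp add: uv inversions_def sh)
    next
      case 2
      then show ?thesis using h ne assms by (simp add: uv inversions_def sh)
    next
      case 3
      then show ?thesis using h ne assms by (simp add: uv inversions_def)
    qed
  qed
  have inv: "map_prod ?f ?f (map_prod ?f ?f p) = p" for p by (cases p) auto
  have "bij_betw (map_prod ?f ?f) (inversions d B - {(x, x - d)}) (inversions d ?B')"
  proof (rule bij_betw_byWitness[where f' = "map_prod ?f ?f"])
    show "map_prod ?f ?f ` (inversions d B - {(x, x - d)}) \<subseteq> inversions d ?B'"
      by (rule image_subsetI) (rule fwd)
    show "map_prod ?f ?f ` inversions d ?B' \<subseteq> inversions d B - {(x, x - d)}"
      by (rule image_subsetI) (rule bwd)
  qed (intro ballI inv)+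
  then have "card (inversions d ?B') = card (inversions d B - {(x, x - d)})"
    by (rule bij_betw_same_card[symmetric])
  moreover have "(x, x - d) \<in> inversions d B" using assms by (auto simp: inversions_def)
  ultimately show ?thesis using finite_inversions[OF assms(1)] card_Suc_Diff1 by metis
qed

lemma inversions_bead_core:
  assumes "bead_core d B" "0 < d"
  shows "inversions d B = {}"
proof -
  have False if h: "x \<in> B" "y \<notin> B" "y < x" "d dvd x - y" for x y
  proof -
    obtain k where k: "x - y = d * k" using h by blast
    then have "0 < k" using h assms(2) by (metis diff_gt_0_iff_gt zero_less_mult_pos)
    then have "y = x - int (nat k) * d" using k by (simp add: algebra_simps)
    then show False using bead_core_mult[OF assms(1) h(1)] h(2) by metis
  qed
  then show ?thesis by (auto simp: inversions_def)
qed

definition excess :: "int \<Rightarrow> int set \<Rightarrow> int \<Rightarrow> int \<Rightarrow> int set" where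
  "excess s B x y = runner s B x - runner s B y"

lemma excess_balance:
  assumes "maya B" "0 < s"
  shows "int (card (excess s B x y)) - int (card (excess s B y x)) = rcharge s B x - rcharge s B y"
  using charge_diff[OF maya_runner[OF assms] maya_runner[OF assms]] by (simp add: excess_def rcharge_def)

lemma finite_excess: "maya B \<Longrightarrow> 0 < s \<Longrightarrow> finite (excess s B x y)"
  by (simp add: excess_def maya_Diff_finite maya_runner)

lemma excess_bead_core:
  assumes "maya C" "0 < s" "bead_core s C"
  shows "excess s C x y = {} \<or> excess s C y x = {}"
proof -
  have "runner s C z = {..<rcharge s C z}" for z
    using bead_core_iff[OF assms] rcharge_shift[OF assms(1,2)] by (auto simp: runner_def)
  then show ?thesis unfolding excess_def
    by (metis Diff_eq_empty_iff lessThan_subset_iff linorder_linear)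
qed

lemma card_excess_core_le:
  assumes "maya B" "maya C" "0 < s" "bead_core s C" "rcharge s B = rcharge s C"
  shows "card (excess s C x y) \<le> card (excess s B x y)"
    and "card (excess s C x y) = card (excess s B x y) \<longleftrightarrow> excess s B x y = {} \<or> excess s B y x = {}"
proof -
  have eq: "int (card (excess s B x y)) - int (card (excess s B y x))
      = int (card (excess s C x y)) - int (card (excess s C y x))"
    using assms excess_balance by simp
  have fin: "finite (excess s B x y)" "finite (excess s B y x)"
    using assms finite_excess by auto
  have z: "card (excess s C x y) = 0 \<or> card (excess s C y x) = 0"
    using excess_bead_core[OF assms(2-4)] by (metis card.empty)
  show "card (excess s C x y) \<le> card (excess s B x y)" using eq z by linarith
  have "card (excess s C x y) = card (excess s B x y) \<longleftrightarrow> card (excess s B x y) = 0 \<or> card (excess s B y x) = 0"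
    using eq z by linarith
  then show "card (excess s C x y) = card (excess s B x y) \<longleftrightarrow> excess s B x y = {} \<or> excess s B y x = {}"
    using fin by simp
qed

lemma card_inversions_eq_sum:
  assumes "{..<-N} \<subseteq> B" "B \<subseteq> {..<N}" "2 * N \<le> K" "0 < t" "0 < s"
  shows "card (inversions t B) = (\<Sum>k\<in>{1..K}. \<Sum>i\<in>{0..<s}. card (excess s B i (i - k * t)))"
proof -
  have m: "maya B" using assms maya_from_bounds by blast
  let ?X = "\<lambda>k. {x \<in> B. x - k * t \<notin> B}"
  have bound: "(x - y) div t \<in> {1..K}" if "(x, y) \<in> inversions t B" for x y
  proof -
    have h: "x \<in> B" "y \<notin> B" "y < x" "t dvd x - y" using that by (auto simp: inversions_def)
    then obtain k where k: "x - y = t * k" by blast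
    then have "0 < k" using h assms(4) by (metis diff_gt_0_iff_gt zero_less_mult_pos)
    moreover have "k * 1 \<le> k * t" using \<open>0 < k\<close> assms(4) by (intro mult_left_mono) auto
    moreover have "x < N" "-N \<le> y" using h assms(1,2) by (auto simp: subset_eq not_less[symmetric])
    ultimately have "1 \<le> k" "k \<le> K" using k assms(3) by (simp_all only: mult.commute[of t] mult_1_right)
    then show ?thesis using k assms(4) by simp
  qed
  have "bij_betw (\<lambda>(k,x). (x, x - k * t)) (SIGMA k:{1..K}. ?X k) (inversions t B)"
  proof (rule bij_betw_byWitness[where f' = "\<lambda>(x,y). ((x - y) div t, x)"])
    show "\<forall>p\<in>SIGMA k:{1..K}. ?X k. (\<lambda>(x,y). ((x - y) div t, x)) ((\<lambda>(k,x). (x, x - k * t)) p) = p"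
      using assms(4) by auto
    show "\<forall>p\<in>inversions t B. (\<lambda>(k,x). (x, x - k * t)) ((\<lambda>(x,y). ((x - y) div t, x)) p) = p"
      by (auto simp: inversions_def)
    show "(\<lambda>(k,x). (x, x - k * t)) ` (SIGMA k:{1..K}. ?X k) \<subseteq> inversions t B"
      using assms(4) by (auto simp: inversions_def)
    show "(\<lambda>(x,y). ((x - y) div t, x)) ` inversions t B \<subseteq> (SIGMA k:{1..K}. ?X k)"
      using bound by (fastforce simp: inversions_def)
  qed
  then have "card (inversions t B) = card (SIGMA k:{1..K}. ?X k)" by (rule bij_betw_same_card[symmetric])
  moreover have finX: "finite (?X k)" for k
  proof -
    have "?X k = B - {x. x + - (k * t) \<in> B}" by (simp add: set_diff_eq)
    then show ?thesis using maya_Diff_finite[OF m maya_shift[OF m], of "- (k * t)"] by (simp only:)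
  qed
  moreover have "card (?X k) = (\<Sum>i\<in>{0..<s}. card (excess s B i (i - k * t)))" for k
  proof -
    have "runner s (?X k) i = excess s B i (i - k * t)" for i
      by (auto simp: runner_def excess_def algebra_simps)
    then show ?thesis using card_eq_sum_residues[OF finX assms(5), of k] by simp
  qed
  ultimately show ?thesis by simp
qed

text \<open>Equivalently: any two \<open>s\<close>-runners, aligned by a translation by a multiple of \<open>t\<close>, are
  comparable under inclusion.\<close>

definition nested :: "int \<Rightarrow> int \<Rightarrow> int set \<Rightarrow> bool" where
  "nested s t B \<longleftrightarrow> (\<nexists>x m k. x \<in> B \<and> x + m * s \<notin> B \<and> x + k * t \<notin> B \<and> x + m * s + k * t \<in> B)"

lemma nested_sym: "nested s t B \<longleftrightarrow> nested t s B"
proof -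
  have "nested t s B" if n: "nested s t B" for s t
    unfolding nested_def
  proof clarify
    fix x m k assume "x \<in> B" "x + m * t \<notin> B" "x + k * s \<notin> B" "x + m * t + k * s \<in> B"
    moreover have "x + m * t + k * s = x + k * s + m * t" by simp
    ultimately show False using n unfolding nested_def by metis
  qed
  then show ?thesis by blast
qed

lemma nested_iff_excess:
  assumes "0 < s"
  shows "nested s t B \<longleftrightarrow> (\<forall>k\<ge>1. \<forall>i\<in>{0..<s}. excess s B i (i - k * t) = {} \<or> excess s B (i - k * t) i = {})"
    (is "_ = ?R")
proof
  assume n: "nested s t B"
  show ?R
  proof (intro allI impI ballI, rule ccontr)
    fix k i assume "\<not> (excess s B i (i - k * t) = {} \<or> excess s B (i - k * t) i = {})"
    then obtain m m' where h: "i + m * s \<in> B" "i - k * t + m * s \<notin> B" "i + m' * s \<notin> B" "i - k * t + m' * s \<in> B"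
      by (auto simp: excess_def runner_def)
    have "i + m * s + (m' - m) * s = i + m' * s" "i + m * s + (-k) * t = i - k * t + m * s"
      "i + m * s + (m' - m) * s + (-k) * t = i - k * t + m' * s" by (simp_all add: algebra_simps)
    then show False using n h unfolding nested_def by metis
  qed
next
  assume r: ?R
  have no: False if h: "x \<in> B" "x + m * s \<notin> B" "x - k * t \<notin> B" "x + m * s - k * t \<in> B" "1 \<le> k" for x m k
  proof -
    let ?i = "x mod s" and ?j = "x div s"
    have x: "x = ?i + ?j * s" by simp
    have "?j \<in> excess s B ?i (?i - k * t)"
    proof -
      have "?i - k * t + ?j * s = x - k * t" by (simp add: algebra_simps)
      then show ?thesis using h(1,3) unfolding excess_def runner_def Diff_iff mem_Collect_eq by (metis x)
    qed
    moreover have "?j + m \<in> excess s B (?i - k * t) ?i"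
    proof -
      have "?i - k * t + (?j + m) * s \<in> B" "?i + (?j + m) * s \<notin> B"
        using h(2,4) by (simp_all add: algebra_simps)
      then show ?thesis unfolding excess_def runner_def by blast
    qed
    moreover have "?i \<in> {0..<s}" using assms by simp
    ultimately show False using r h(5) by blast
  qed
  show "nested s t B"
    unfolding nested_def
  proof clarify
    fix x m k assume h: "x \<in> B" "x + m * s \<notin> B" "x + k * t \<notin> B" "x + m * s + k * t \<in> B"
    have "k \<noteq> 0" using h by auto
    then consider "1 \<le> -k" | "1 \<le> k" by linarith
    then show False
    proof cases
      case 1
      then show ?thesis using no[of x m "-k"] h by simp
    next
      case 2
      have "x + m * s + k * t + (-m) * s = x + k * t" "x + m * s + k * t - k * t = x + m * s"
        "x + m * s + k * t + (-m) * s - k * t = x" by (simp_all add: algebra_simps)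
      then show ?thesis using no[of "x + m * s + k * t" "-m" k] h 2 by metis
    qed
  qed
qed

lemma card_inversions_core_le:
  assumes "maya B" "maya C" "0 < s" "0 < t" "bead_core s C" "rcharge s B = rcharge s C"
  shows "card (inversions t C) \<le> card (inversions t B)"
    and "card (inversions t C) = card (inversions t B) \<longleftrightarrow> nested s t B"
proof -
  obtain N1 where N1: "0 \<le> N1" "{..<-N1} \<subseteq> B" "B \<subseteq> {..<N1}" using maya_bounds[OF assms(1)] by metis
  obtain N2 where N2: "0 \<le> N2" "{..<-N2} \<subseteq> C" "C \<subseteq> {..<N2}" using maya_bounds[OF assms(2)] by metis
  let ?e = "\<lambda>B k i. card (excess s B i (i - k * t))"
  have sums: "card (inversions t B) = (\<Sum>k\<in>{1..K}. \<Sum>i\<in>{0..<s}. ?e B k i)"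
    "card (inversions t C) = (\<Sum>k\<in>{1..K}. \<Sum>i\<in>{0..<s}. ?e C k i)" if "K \<ge> 2 * max N1 N2" for K
    using card_inversions_eq_sum[OF N1(2,3) _ assms(4,3), of K]
      card_inversions_eq_sum[OF N2(2,3) _ assms(4,3), of K] that by auto
  have le: "?e C k i \<le> ?e B k i" for k i
    using card_excess_core_le(1)[OF assms(1,2,3,5,6)] .
  have eqi: "?e C k i = ?e B k i \<longleftrightarrow> excess s B i (i - k * t) = {} \<or> excess s B (i - k * t) i = {}" for k i
    using card_excess_core_le(2)[OF assms(1,2,3,5,6)] .
  show "card (inversions t C) \<le> card (inversions t B)"
    unfolding sums[OF order_refl] by (intro sum_mono le)
  show "card (inversions t C) = card (inversions t B) \<longleftrightarrow> nested s t B"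
  proof
    assume eq: "card (inversions t C) = card (inversions t B)"
    have "?e C k i = ?e B k i" if "1 \<le> k" "i \<in> {0..<s}" for k i
    proof -
      let ?K = "max k (2 * max N1 N2)"
      have s1: "(\<Sum>k\<in>{1..?K}. \<Sum>i\<in>{0..<s}. ?e C k i) = (\<Sum>k\<in>{1..?K}. \<Sum>i\<in>{0..<s}. ?e B k i)"
        using eq sums[of ?K] by simp
      have k: "k \<in> {1..?K}" using that by simp
      have "(\<Sum>i\<in>{0..<s}. ?e C k i) = (\<Sum>i\<in>{0..<s}. ?e B k i)"
        by (rule sum_mono_inv[OF s1 _ k]) (auto intro: sum_mono le)
      then show ?thesis by (rule sum_mono_inv[OF _ _ that(2)]) (auto intro: le)
    qed
    then show "nested s t B" using eqi nested_iff_excess[OF assms(3)] by blast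
  next
    assume "nested s t B"
    then have "?e C k i = ?e B k i" if "1 \<le> k" "i \<in> {0..<s}" for k i
      using eqi nested_iff_excess[OF assms(3)] that by blast
    then show "card (inversions t C) = card (inversions t B)"
      unfolding sums[OF order_refl] by (intro sum.cong) auto
  qed
qed

lemma nested_rcharge_less:
  assumes "maya B" "0 < s" "nested s t B" "x \<in> B" "x + k * t \<notin> B"
  shows "rcharge s B (x + k * t) < rcharge s B x"
proof -
  have "runner s B (x + k * t) \<subseteq> runner s B x"
  proof
    fix m assume m: "m \<in> runner s B (x + k * t)"
    then have "x + m * s + k * t \<in> B" by (simp add: runner_def ac_simps)
    then show "m \<in> runner s B x" using assms(3-5) unfolding nested_def runner_def by blast
  qed
  moreover have "0 \<in> runner s B x" "0 \<notin> runner s B (x + k * t)" using assms by (auto simp: runner_def)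
  ultimately have "runner s B (x + k * t) \<subset> runner s B x" by blast
  then show ?thesis unfolding rcharge_def using charge_strict_mono maya_runner assms(1,2) by blast
qed

lemma nested_unique:
  assumes "maya B" "maya C" "0 < s" "0 < t" "nested s t B" "nested s t C"
    and "rcharge s B = rcharge s C" "rcharge t B = rcharge t C"
  shows "B = C"
proof -
  have "B \<subseteq> C" if h: "maya B" "maya C" "nested s t B" "nested s t C"
    "rcharge s B = rcharge s C" "rcharge t B = rcharge t C" for B C
  proof
    fix x assume x: "x \<in> B"
    show "x \<in> C"
    proof (rule ccontr)
      assume x': "x \<notin> C"
      have "charge (runner t B x) = charge (runner t C x)" using h(6) unfolding rcharge_def by metis
      then have "\<not> runner t C x \<subset> runner t B x"
        using charge_strict_mono maya_runner h(1,2) assms(4) by (metis less_irrefl)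
      moreover have "0 \<in> runner t B x" "0 \<notin> runner t C x" using x x' by (auto simp: runner_def)
      ultimately obtain k where "k \<in> runner t C x" "k \<notin> runner t B x" by blast
      then have k: "x + k * t \<in> C" "x + k * t \<notin> B" by (auto simp: runner_def)
      have "rcharge s B (x + k * t) < rcharge s B x"
        using nested_rcharge_less[OF h(1) assms(3) h(3) x k(2)] .
      moreover have "rcharge s C x < rcharge s C (x + k * t)"
        using nested_rcharge_less[OF h(2) assms(3) h(4) k(1), of "-k"] x' by simp
      ultimately show False using h(5) by simp
    qed
  qed
  then show ?thesis using assms by (metis subset_antisym)
qed

lemma nested_core_core_pos:
  assumes "maya B" "maya S" "maya T" "0 < s" "0 < t" "nested s t B"
    and "bead_core s S" "rcharge s B = rcharge s S" "bead_core t T" "rcharge t B = rcharge t T"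
    and "0 < rcharge s T y"
  shows "0 < rcharge t S y"
proof (rule ccontr)
  assume neg: "\<not> 0 < rcharge t S y"
  let ?S = "runner t S y" and ?\<rho> = "\<lambda>k. rcharge s B (y + k * t)"
  have S: "k \<in> ?S \<longleftrightarrow> 0 < ?\<rho> k" for k
    using bead_core_iff[OF assms(2,4,7)] assms(8) by (simp add: runner_def)
  have mS: "maya ?S" using maya_runner[OF assms(2,5)] .
  then obtain N where "?S \<subseteq> {..<N}" using maya_bounds by metis
  then have "N \<notin> ?S" by auto
  then obtain k where k: "k \<notin> ?S" "\<And>l. l \<notin> ?S \<Longrightarrow> nat (- ?\<rho> k) \<le> nat (- ?\<rho> l)"
    using ex_has_least_nat[of "\<lambda>l. l \<notin> ?S" N "\<lambda>l. nat (- ?\<rho> l)"] by blast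
  have max: "?\<rho> l \<le> ?\<rho> k" if "l \<notin> ?S" for l
    using k(2)[OF that] k(1) that unfolding S by linarith
  have "runner s T y \<subseteq> runner s B (y + k * t)"
  proof
    fix m assume "m \<in> runner s T y"
    then have "0 < rcharge t B (y + m * s)"
      using bead_core_iff[OF assms(3,5,9)] assms(10) by (simp add: runner_def)
    then have "\<not> runner t B (y + m * s) \<subseteq> ?S"
      using neg charge_mono[OF maya_runner[OF assms(1,5)] mS] unfolding rcharge_def by force
    then obtain l where l: "y + m * s + l * t \<in> B" "l \<notin> ?S" by (auto simp: runner_def)
    have "y + m * s + k * t \<in> B"
    proof (rule ccontr)
      assume n: "y + m * s + k * t \<notin> B"
      have e: "y + m * s + l * t + (k - l) * t = y + m * s + k * t" by (simp add: algebra_simps)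
      have "rcharge s B (y + m * s + k * t) < rcharge s B (y + m * s + l * t)"
        using nested_rcharge_less[OF assms(1,4,6) l(1), of "k - l"] n unfolding e by blast
      moreover have "rcharge s B (y + m * s + j * t) = ?\<rho> j - m" for j
        using rcharge_shift[OF assms(1,4), of "y + j * t" m] by (simp add: ac_simps)
      ultimately show False using max[OF l(2)] by simp
    qed
    then show "m \<in> runner s B (y + k * t)" by (simp add: runner_def ac_simps)
  qed
  then have "rcharge s T y \<le> ?\<rho> k"
    unfolding rcharge_def using charge_mono maya_runner assms by blast
  then show False using assms(11) k(1) unfolding S by simp
qed

text \<open>Sorting the \<open>s\<close>-runners and the \<open>t\<close>-runners by their charges turns a nested configuration
  into its common core, as in the Gale--Ryser theorem; \<open>glue\<close> undoes the sorting. Here the charges of the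
  runners are read off an \<open>s\<close>-core \<open>S\<close> and a \<open>t\<close>-core \<open>T\<close>, and the common core
  is the set of \<open>y\<close> with \<open>0 < rcharge t S y\<close>.\<close>

definition glue :: "int \<Rightarrow> int \<Rightarrow> int set \<Rightarrow> int set \<Rightarrow> int set" where
  "glue s t S T = {x. rcharge t S (x + s * rcharge s S x + t * rcharge t T x - t) \<le> 0}"

lemma rcharge_strict_at_level:
  assumes "maya S" "0 < s" "0 < t" "bead_core s S"
  shows "rcharge t S (x + s * rcharge s S x) < rcharge t S (x + s * rcharge s S x - s)"
proof -
  define r where "r = rcharge s S x"
  have mem: "k \<in> runner t S (x + s * m) \<longleftrightarrow> m < rcharge s S (x + k * t)" for k m
    using bead_core_iff[OF assms(1,2,4), of "x + s * m + k * t"]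
      rcharge_shift[OF assms(1,2), of "x + k * t" m] by (simp add: runner_def ac_simps)
  have e: "x + s * r - s = x + s * (r - 1)" by (simp add: algebra_simps)
  have "runner t S (x + s * r) \<subseteq> runner t S (x + s * (r - 1))"
    unfolding subset_iff mem by auto
  moreover have "0 \<in> runner t S (x + s * (r - 1))" "0 \<notin> runner t S (x + s * r)"
    unfolding mem r_def by auto
  ultimately have "runner t S (x + s * r) \<subset> runner t S (x + s * (r - 1))" by blast
  then have "rcharge t S (x + s * r) < rcharge t S (x + s * (r - 1))"
    unfolding rcharge_def by (intro charge_strict_mono maya_runner assms)
  then show ?thesis using e unfolding r_def by metis
qed

lemma glue_sym:
  assumes "maya S" "maya T" "0 < s" "0 < t" "bead_core s S" "bead_core t T"
    and K: "\<And>y. 0 < rcharge t S y \<longleftrightarrow> 0 < rcharge s T y"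
  shows "glue s t S T = glue t s T S"
proof -
  have "glue s t S T \<subseteq> glue t s T S"
    if h: "maya S" "maya T" "0 < s" "0 < t" "bead_core s S" "bead_core t T"
      "\<And>y. 0 < rcharge t S y \<longleftrightarrow> 0 < rcharge s T y" for s t S T
  proof
    fix x assume "x \<in> glue s t S T"
    define z where "z = x + s * rcharge s S x + t * rcharge t T x"
    have "rcharge t S (z - t) \<le> 0" using \<open>x \<in> _\<close> by (simp add: glue_def z_def)
    then have "rcharge s T (z - t) \<le> 0" using h(7)[of "z - t"] by linarith
    moreover have "rcharge s T z < rcharge s T (z - t)"
    proof -
      let ?g = "x + t * rcharge t T x"
      have "rcharge s T ?g < rcharge s T (?g - t)"
        using rcharge_strict_at_level[OF h(2,4,3,6)] .
      moreover have z: "z = ?g + rcharge s S x * s" "z - t = ?g - t + rcharge s S x * s"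
        by (simp_all add: z_def algebra_simps)
      moreover have "rcharge s T z = rcharge s T ?g - rcharge s S x"
        unfolding z(1) by (rule rcharge_shift[OF h(2,3)])
      moreover have "rcharge s T (z - t) = rcharge s T (?g - t) - rcharge s S x"
        unfolding z(2) by (rule rcharge_shift[OF h(2,3)])
      ultimately show ?thesis by linarith
    qed
    moreover have "rcharge s T (z - s) = rcharge s T z + 1"
      using rcharge_shift[OF h(2,3), of z "-1"] by simp
    ultimately have "rcharge s T (z - s) \<le> 0" by linarith
    then show "x \<in> glue t s T S" by (simp add: glue_def z_def ac_simps)
  qed
  from this[OF assms] this[OF assms(2,1,4,3,6,5) K[symmetric]] show ?thesis by blast
qed

lemma glue_runner:
  assumes "maya S" "maya T" "0 < s" "0 < t" "bead_core s S" "bead_core t T"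
    and K: "\<And>y. 0 < rcharge t S y \<longleftrightarrow> 0 < rcharge s T y"
  defines "M \<equiv> \<lambda>x. rcharge s T (x + t * rcharge t T x - t) - 1"
  shows "x + k * t \<in> glue s t S T \<longleftrightarrow> M x < rcharge s S (x + k * t)"
    and "maya (runner t (glue s t S T) x)"
    and "rcharge t (glue s t S T) x = rcharge t T x"
proof -
  let ?\<rho> = "\<lambda>k. rcharge s S (x + k * t)" and ?\<gamma> = "rcharge t T x"
  have mem: "k \<in> runner t S (x + m * s) \<longleftrightarrow> m < ?\<rho> k" for k m
    using bead_core_iff[OF assms(1,3,5), of "x + m * s + k * t"]
      rcharge_shift[OF assms(1,3), of "x + k * t" m] by (simp add: runner_def ac_simps)
  have z: "x + k * t + s * ?\<rho> k + t * rcharge t T (x + k * t) = x + t * ?\<gamma> + ?\<rho> k * s" for k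
    unfolding rcharge_shift[OF assms(2,4), of x k] by (simp add: algebra_simps)
  have low: "x + k * t \<in> glue s t S T \<longleftrightarrow> M x < ?\<rho> k" for k
  proof -
    have "x + k * t \<in> glue s t S T \<longleftrightarrow> rcharge s T (x + t * ?\<gamma> + ?\<rho> k * s - t) \<le> 0"
      unfolding glue_def mem_Collect_eq z using K[of "x + t * ?\<gamma> + ?\<rho> k * s - t"] by linarith
    also have "x + t * ?\<gamma> + ?\<rho> k * s - t = (x + t * ?\<gamma> - t) + ?\<rho> k * s" by simp
    finally show ?thesis unfolding M_def rcharge_shift[OF assms(2,3)] by auto
  qed
  have high: "x + k * t \<in> glue s t S T \<longleftrightarrow> rcharge s T (x + t * ?\<gamma>) < ?\<rho> k" for k
  proof -
    have "x + k * t \<in> glue s t S T \<longleftrightarrow> rcharge s T (x + k * t + t * rcharge t T (x + k * t) + s * ?\<rho> k - s) \<le> 0"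
      unfolding glue_sym[OF assms(1-6) K] by (simp add: glue_def)
    also have "x + k * t + t * rcharge t T (x + k * t) + s * ?\<rho> k - s = x + t * ?\<gamma> + (?\<rho> k - 1) * s"
      using z[of k] by (simp add: algebra_simps)
    finally show ?thesis unfolding rcharge_shift[OF assms(2,3)] by auto
  qed
  show "x + k * t \<in> glue s t S T \<longleftrightarrow> M x < ?\<rho> k" by (rule low)
  have r1: "runner t (glue s t S T) x = runner t S (x + M x * s)"
    using low mem by (auto simp: runner_def[of t "glue s t S T"])
  have r2: "runner t (glue s t S T) x = runner t S (x + rcharge s T (x + t * ?\<gamma>) * s)"
    using high mem by (auto simp: runner_def[of t "glue s t S T"])
  show "maya (runner t (glue s t S T) x)" unfolding r1 using maya_runner[OF assms(1,4)] .
  have "?\<gamma> \<le> rcharge t S (x + M x * s)"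
  proof -
    have "rcharge s T ((x + t * ?\<gamma> - t) + M x * s) = 1"
      using rcharge_shift[OF assms(2,3)] unfolding M_def by simp
    then have "0 < rcharge t S ((x + M x * s) + (?\<gamma> - 1) * t)"
      using K[of "(x + t * ?\<gamma> - t) + M x * s"] by (simp add: algebra_simps)
    then show ?thesis using rcharge_shift[OF assms(1,4)] by simp
  qed
  moreover have "rcharge t S (x + rcharge s T (x + t * ?\<gamma>) * s) \<le> ?\<gamma>"
  proof -
    let ?m = "rcharge s T (x + t * ?\<gamma>)"
    have "rcharge s T ((x + t * ?\<gamma>) + ?m * s) = 0" using rcharge_shift[OF assms(2,3)] by simp
    then have "\<not> 0 < rcharge t S ((x + ?m * s) + ?\<gamma> * t)"
      using K[of "(x + t * ?\<gamma>) + ?m * s"] by (simp add: algebra_simps)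
    then show ?thesis using rcharge_shift[OF assms(1,4)] by simp
  qed
  ultimately show "rcharge t (glue s t S T) x = ?\<gamma>"
    unfolding rcharge_def[of t "glue s t S T"] using r1 r2 by (metis order_antisym rcharge_def)
qed

lemma nested_exists:
  assumes "maya S" "maya T" "0 < s" "0 < t" "bead_core s S" "bead_core t T"
    and K: "\<And>y. 0 < rcharge t S y \<longleftrightarrow> 0 < rcharge s T y"
  obtains B where "maya B" "nested s t B" "rcharge s B = rcharge s S" "rcharge t B = rcharge t T"
proof
  let ?B = "glue s t S T"
  show "maya ?B" using maya_from_runners[OF glue_runner(2)[OF assms]] assms(4) by blast
  show "rcharge t ?B = rcharge t T" using glue_runner(3)[OF assms] by blast
  show "rcharge s ?B = rcharge s S"
    using glue_runner(3)[OF assms(2,1,4,3,6,5) K[symmetric]] glue_sym[OF assms] by auto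
  show "nested s t ?B"
    unfolding nested_def
  proof clarify
    fix x m k
    assume h: "x \<in> ?B" "x + m * s \<notin> ?B" "x + k * t \<notin> ?B" "x + m * s + k * t \<in> ?B"
    have "rcharge s S (x + k * t) < rcharge s S x"
      using glue_runner(1)[OF assms, of x 0] glue_runner(1)[OF assms, of x k] h by simp
    moreover have "rcharge s S (x + m * s) < rcharge s S (x + m * s + k * t)"
      using glue_runner(1)[OF assms, of "x + m * s" 0] glue_runner(1)[OF assms, of "x + m * s" k] h by simp
    moreover have "rcharge s S (x + m * s) = rcharge s S x - m"
      "rcharge s S (x + m * s + k * t) = rcharge s S (x + k * t) - m"
      using rcharge_shift[OF assms(1,3), of x m] rcharge_shift[OF assms(1,3), of "x + k * t" m]
      by (simp_all add: ac_simps)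
    ultimately show False by simp
  qed
qed

lemma rcharge_eq_charge_eq:
  assumes "maya B" "maya C" "0 < d" "rcharge d B = rcharge d C"
  shows "charge B = charge C"
  using charge_diff_residues[OF assms(1-3)] assms(4) by simp

lemma rcharge_eqI:
  assumes "maya B" "maya C" "0 < d" "\<And>i. i \<in> {0..<d} \<Longrightarrow> rcharge d B i = rcharge d C i"
  shows "rcharge d B = rcharge d C"
proof
  fix x
  have "rcharge d D x = rcharge d D (x mod d) - x div d" if "maya D" for D
    using rcharge_shift[OF that assms(3), of "x mod d" "x div d"] by simp
  then show "rcharge d B x = rcharge d C x" using assms by simp
qed

text \<open>A bead far to the left can be moved along its \<open>s\<close>-runner to a vacant position far to the right in any
  prescribed residue class modulo \<open>t\<close>; such moves transport charge between the \<open>t\<close>-runners.\<close>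

lemma common_charges_exist:
  fixes s t :: int
  assumes "maya S" "maya T" "0 < s" "0 < t" "coprime s t" "charge S = charge T"
  obtains B where "maya B" "rcharge s B = rcharge s S" "rcharge t B = rcharge t T"
proof -
  let ?D = "\<lambda>B. \<Sum>i\<in>{0..<t}. nat \<bar>rcharge t B i - rcharge t T i\<bar>"
  let ?P = "\<lambda>B. maya B \<and> rcharge s B = rcharge s S"
  obtain B where B: "maya B" "rcharge s B = rcharge s S" and min: "\<And>C. ?P C \<Longrightarrow> ?D B \<le> ?D C"
    using ex_has_least_nat[of ?P S ?D] assms(1) by blast
  have "rcharge t B i = rcharge t T i" if "i \<in> {0..<t}" for i
  proof (rule ccontr)
    assume ne: "rcharge t B i \<noteq> rcharge t T i"
    let ?f = "\<lambda>i. rcharge t B i - rcharge t T i"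
    have sum0: "(\<Sum>i\<in>{0..<t}. ?f i) = 0"
      using charge_diff_residues[OF B(1) assms(2,4)] rcharge_eq_charge_eq[OF B(1) assms(1,3) B(2)] assms(6)
      by simp
    have "\<exists>a\<in>{0..<t}. 0 < ?f a"
    proof (rule ccontr)
      assume "\<not> ?thesis"
      then have "\<forall>a\<in>{0..<t}. - ?f a = 0"
        using sum_nonneg_eq_0_iff[of "{0..<t}" "\<lambda>a. - ?f a"] sum0
        by (simp only: sum_negf) (simp add: not_less)
      then show False using that ne by auto
    qed
    then obtain a where a: "a \<in> {0..<t}" "0 < ?f a" by blast
    have "\<exists>b\<in>{0..<t}. ?f b < 0"
    proof (rule ccontr)
      assume "\<not> ?thesis"
      then have "\<forall>a\<in>{0..<t}. ?f a = 0"
        using sum_nonneg_eq_0_iff[of "{0..<t}" ?f] sum0 by (simp add: not_less)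
      then show False using that ne by auto
    qed
    then obtain b where b: "b \<in> {0..<t}" "?f b < 0" by blast
    obtain N where N: "0 \<le> N" "{..<-N} \<subseteq> B" "B \<subseteq> {..<N}" using maya_bounds[OF B(1)] by metis
    define x where "x = a - (N + a + 1) * t"
    have "(N + a + 1) * 1 \<le> (N + a + 1) * t" using N(1) a(1) assms(4) by (intro mult_left_mono) auto
    then have "x < -N" unfolding x_def by simp
    then have xB: "x \<in> B" using N(2) by auto
    obtain u v where uv: "u * s + v * t = 1" using assms(5) by (metis bezout_int coprime_iff_gcd_eq_1)
    define L where "L = N + \<bar>x\<bar> + \<bar>(b - x) * u * s\<bar>"
    define y where "y = x + (b - x) * u * s + L * t * s"
    have "1 * 1 \<le> t * s" using assms(3,4) by (intro mult_mono) auto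
    then have "L * 1 \<le> L * (t * s)" using N(1) by (intro mult_left_mono) (auto simp: L_def)
    then have "N \<le> y" unfolding y_def L_def by (simp add: ac_simps)
    then have yB: "y \<notin> B" using N(3) by auto
    have ys: "s dvd y - x" unfolding y_def by (simp add: dvd_add)
    have "y - b = (L * s - (b - x) * v) * t"
    proof -
      have "y - b = (b - x) * (u * s) - (b - x) + L * s * t" by (simp add: y_def algebra_simps)
      also have "u * s = 1 - v * t" using uv by simp
      finally show ?thesis by (simp add: algebra_simps)
    qed
    then have yb: "t dvd y - b" by simp
    have xa: "t dvd x - a" unfolding x_def by simp
    let ?C = "insert y (B - {x})"
    have "?P ?C" using maya_move[OF B(1)] rcharge_move_runner[OF B(1) assms(3) xB yB ys] B(2) by simp
    then have "?D B \<le> ?D ?C" by (rule min)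
    have res: "t dvd z - c \<longleftrightarrow> c = i" if "t dvd z - i" "i \<in> {0..<t}" "c \<in> {0..<t}" for z c i
    proof -
      have "t dvd z - c \<longleftrightarrow> z mod t = c" "t dvd z - i \<longleftrightarrow> z mod t = i"
        using that(2,3) by (simp_all add: mod_eq_dvd_iff[symmetric])
      then show ?thesis using that(1) by auto
    qed
    have rc: "rcharge t ?C c = rcharge t B c - (if c = a then 1 else 0) + (if c = b then 1 else 0)"
      if "c \<in> {0..<t}" for c
      using rcharge_move[OF B(1) assms(4) xB yB, of c] res[OF xa a(1) that] res[OF yb b(1) that] by simp
    have "?D ?C < ?D B"
    proof (rule sum_strict_mono_ex1)
      show "\<forall>c\<in>{0..<t}. nat \<bar>rcharge t ?C c - rcharge t T c\<bar> \<le> nat \<bar>?f c\<bar>"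
        using rc a(2) b(2) by auto
      show "\<exists>c\<in>{0..<t}. nat \<bar>rcharge t ?C c - rcharge t T c\<bar> < nat \<bar>?f c\<bar>"
        using rc[OF a(1)] a b(2) by (intro bexI[of _ a]) auto
    qed simp
    then show False using \<open>?D B \<le> ?D ?C\<close> by simp
  qed
  then have "rcharge t B = rcharge t T" by (intro rcharge_eqI B(1) assms)
  then show ?thesis using that B by blast
qed

section \<open>Beta-sets\<close>

text \<open>Rows are indexed from 0; the empty partition corresponds to the negative integers.\<close>

definition beta :: "(nat \<Rightarrow> nat) \<Rightarrow> int set" where
  "beta p = range (\<lambda>i. int (p i) - int i - 1)"

lemma partition_antimono: "is_partition p \<Longrightarrow> i \<le> j \<Longrightarrow> p j \<le> p i"
  by (simp add: is_partition_def antimonoD)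

lemma partition_eventually_0:
  assumes "is_partition p"
  obtains n where "\<And>i. n \<le> i \<Longrightarrow> p i = 0"
proof -
  have "finite {i. p i \<noteq> 0}" using assms by (simp add: is_partition_def)
  then obtain n where "\<forall>i\<in>{i. p i \<noteq> 0}. i < n" using finite_nat_set_iff_bounded by blast
  then show ?thesis using that[of n] by (metis mem_Collect_eq not_less)
qed

lemma beta_bounds:
  assumes "is_partition p"
  obtains N where "{..<-N} \<subseteq> beta p" "beta p \<subseteq> {..<N}"
proof -
  obtain n where n: "\<And>i. n \<le> i \<Longrightarrow> p i = 0" using partition_eventually_0[OF assms] by metis
  show ?thesis
  proof (rule that[of "int n + int (p 0)"])
    show "{..<-(int n + int (p 0))} \<subseteq> beta p"
    proof
      fix x assume "x \<in> {..<-(int n + int (p 0))}"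
      then have "n \<le> nat (-x - 1)" "x < 0" by auto
      then have "x = int (p (nat (-x - 1))) - int (nat (-x - 1)) - 1" using n by simp
      then show "x \<in> beta p" unfolding beta_def by blast
    qed
    show "beta p \<subseteq> {..<int n + int (p 0)}"
    proof
      fix x assume "x \<in> beta p"
      then obtain i where i: "x = int (p i) - int i - 1" by (auto simp: beta_def)
      then show "x \<in> {..<int n + int (p 0)}" using partition_antimono[OF assms, of 0 i] by simp
    qed
  qed
qed

lemma maya_beta: "is_partition p \<Longrightarrow> maya (beta p)"
  using beta_bounds maya_from_bounds by metis

lemma beta_strict:
  assumes "is_partition p" "i < j"
  shows "int (p j) - int j - 1 < int (p i) - int i - 1"
  using partition_antimono[OF assms(1), of i j] assms(2) by simp

lemma beta_index_inj:
  assumes "is_partition p" "int (p i) - int i - 1 = int (p j) - int j - 1"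
  shows "i = j"
  using beta_strict[OF assms(1), of i j] beta_strict[OF assms(1), of j i] assms(2)
  by (cases i j rule: linorder_cases) auto

lemma beta_inj:
  assumes "is_partition p" "is_partition q" "beta p = beta q"
  shows "p = q"
proof (rule ccontr)
  assume "p \<noteq> q"
  then have ex: "\<exists>i. p i \<noteq> q i" by auto
  define i where "i = (LEAST i. p i \<noteq> q i)"
  have i: "p i \<noteq> q i" unfolding i_def using ex by (rule LeastI_ex)
  have below: "p k = q k" if "k < i" for k using not_less_Least that unfolding i_def by blast
  have no: False if h: "is_partition p" "is_partition q" "beta p = beta q" "p i > q i"
    "\<And>k. k < i \<Longrightarrow> p k = q k" for p q :: "nat \<Rightarrow> nat"
  proof -
    have "int (p i) - int i - 1 \<in> beta q" unfolding h(3)[symmetric] by (auto simp: beta_def)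
    then obtain k where k: "int (p i) - int i - 1 = int (q k) - int k - 1" by (auto simp: beta_def)
    show False
    proof (cases "k < i")
      case True
      then show False using beta_index_inj[OF h(1), of i k] k h(5)[of k] by simp
    next
      case False
      then show False using partition_antimono[OF h(2), of i k] k h(4) by simp
    qed
  qed
  show False
    using no[of p q] no[of q p] i below assms by (metis linorder_neqE_nat)
qed

lemma beta_add_node:
  assumes "is_partition q" "x \<in> beta q" "x + 1 \<notin> beta q"
  obtains p where "is_partition p" "beta p = insert (x + 1) (beta q - {x})"
proof -
  obtain i where i: "x = int (q i) - int i - 1" using assms(2) by (auto simp: beta_def)
  let ?p = "q(i := Suc (q i))"
  have "?p (Suc k) \<le> ?p k" for k
  proof (cases "Suc k = i")
    case True
    have "int (q k) - int k - 1 \<in> beta q" by (auto simp: beta_def)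
    then have "int (q k) - int k - 1 \<noteq> x + 1" using assms(3) by metis
    then have "q k \<noteq> q i" using i True by auto
    then show ?thesis using partition_antimono[OF assms(1), of k i] True by auto
  next
    case False
    then show ?thesis using partition_antimono[OF assms(1), of k "Suc k"] by auto
  qed
  then have "antimono ?p" by (simp add: antimono_iff_le_Suc)
  moreover have "{k. ?p k \<noteq> 0} \<subseteq> insert i {k. q k \<noteq> 0}" by auto
  then have "finite {k. ?p k \<noteq> 0}" using assms(1) finite_subset unfolding is_partition_def by blast
  ultimately have "is_partition ?p" by (simp add: is_partition_def)
  moreover have "beta ?p = insert (x + 1) (beta q - {x})"
  proof
    show "beta ?p \<subseteq> insert (x + 1) (beta q - {x})"
    proof
      fix y assume "y \<in> beta ?p"
      then obtain k where k: "y = int (?p k) - int k - 1" by (auto simp: beta_def)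
      show "y \<in> insert (x + 1) (beta q - {x})"
        using k i beta_index_inj[OF assms(1), of k i] by (cases "k = i") (auto simp: beta_def)
    qed
    show "insert (x + 1) (beta q - {x}) \<subseteq> beta ?p"
    proof
      fix y assume y: "y \<in> insert (x + 1) (beta q - {x})"
      show "y \<in> beta ?p"
      proof (cases "y = x + 1")
        case True
        then have "y = int (?p i) - int i - 1" using i by simp
        then show ?thesis unfolding beta_def by blast
      next
        case False
        then obtain k where k: "y = int (q k) - int k - 1" "y \<noteq> x" using y by (auto simp: beta_def)
        then have "y = int (?p k) - int k - 1" using i by auto
        then show ?thesis unfolding beta_def by blast
      qed
    qed
  qed
  ultimately show ?thesis using that by blast
qed

lemma is_partition_zero: "is_partition (\<lambda>_. 0)"
  by (simp add: is_partition_def antimono_def)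

lemma beta_zero: "beta (\<lambda>_. 0) = {..<0}"
proof
  show "{..<0} \<subseteq> beta (\<lambda>_. 0)"
  proof
    fix x :: int assume "x \<in> {..<0}"
    then have "x = int 0 - int (nat (-x - 1)) - 1" by simp
    then show "x \<in> beta (\<lambda>_. 0)" unfolding beta_def by blast
  qed
qed (auto simp: beta_def)

lemma down_closed_charge_0:
  assumes "maya B" "charge B = 0" "\<And>x. x \<in> B \<Longrightarrow> x - 1 \<in> B"
  shows "B = {..<0}"
proof -
  have c: "bead_core 1 B" using assms(3) by (simp add: bead_core_def)
  have "runner 1 B 0 = B" by (simp add: runner_def)
  then have "rcharge 1 B x = - x" for x
    using rcharge_shift[OF assms(1), of 1 0 x] assms(2) by (simp add: rcharge_def)
  then show ?thesis using bead_core_iff[OF assms(1) _ c] by auto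
qed

lemma beta_surj:
  assumes "maya B" "charge B = 0"
  obtains p where "is_partition p" "beta p = B"
proof -
  obtain N where N: "{..<-N} \<subseteq> B" "B \<subseteq> {..<N}" using maya_bounds[OF assms(1)] by metis
  have "\<exists>p. is_partition p \<and> beta p = B"
    using assms N
  proof (induction "\<Sum>x\<in>B \<inter> {-N..<N}. nat (x + N)" arbitrary: B rule: less_induct)
    case less
    show ?case
    proof (cases "\<forall>x\<in>B. x - 1 \<in> B")
      case True
      then show ?thesis using down_closed_charge_0[OF less.prems(1,2)] is_partition_zero beta_zero by blast
    next
      case False
      then obtain x where x: "x \<in> B" "x - 1 \<notin> B" by blast
      let ?C = "insert (x - 1) (B - {x})"
      have xN: "x < N" "-N \<le> x - 1" using x less.prems(3,4) by (auto simp: subset_eq not_less[symmetric])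
      have "?C \<inter> {-N..<N} = insert (x - 1) (B \<inter> {-N..<N} - {x})" using xN by auto
      moreover have "(\<Sum>x\<in>B \<inter> {-N..<N}. nat (x + N)) = nat (x + N) + (\<Sum>x\<in>B \<inter> {-N..<N} - {x}. nat (x + N))"
        using x xN by (intro sum.remove) auto
      ultimately have "(\<Sum>x\<in>?C \<inter> {-N..<N}. nat (x + N)) < (\<Sum>x\<in>B \<inter> {-N..<N}. nat (x + N))"
        using x xN by simp
      moreover have "maya ?C" "charge ?C = 0"
        using maya_move[OF less.prems(1)] charge_move[OF less.prems(1) x] less.prems(2) by auto
      moreover have "{..<-N} \<subseteq> ?C" "?C \<subseteq> {..<N}" using less.prems(3,4) xN by auto
      ultimately obtain q where q: "is_partition q" "beta q = ?C" using less.hyps by blast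
      have "x - 1 \<in> beta q" "(x - 1) + 1 \<notin> beta q" using q(2) by auto
      then obtain p where p: "is_partition p" "beta p = insert ((x - 1) + 1) (beta q - {x - 1})"
        using beta_add_node[OF q(1)] by metis
      moreover have "insert ((x - 1) + 1) (beta q - {x - 1}) = B" using q(2) x by auto
      ultimately show ?thesis by metis
    qed
  qed
  then show ?thesis using that by blast
qed

lemma charge_beta:
  assumes "is_partition p"
  shows "charge (beta p) = 0"
proof -
  obtain n where n: "\<And>i. n \<le> i \<Longrightarrow> p i = 0" using partition_eventually_0[OF assms] by metis
  let ?e = "\<lambda>i. int (p i) - int i - 1"
  have inj: "inj ?e" using beta_index_inj[OF assms] by (auto simp: inj_def)
  have "beta p \<inter> {- int n..} = ?e ` {..<n}"
  proof
    show "beta p \<inter> {- int n..} \<subseteq> ?e ` {..<n}"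
    proof
      fix x assume "x \<in> beta p \<inter> {- int n..}"
      then obtain i where i: "x = ?e i" "- int n \<le> x" by (auto simp: beta_def)
      then have "i < n" using n[of i] by (cases "i < n") auto
      then show "x \<in> ?e ` {..<n}" using i by blast
    qed
    show "?e ` {..<n} \<subseteq> beta p \<inter> {- int n..}" by (auto simp: beta_def)
  qed
  then have "card (beta p \<inter> {- int n..}) = n" using card_image[OF inj_on_subset[OF inj]] by simp
  moreover have "{..< - int n} - beta p = {}"
  proof -
    have "x \<in> beta p" if "x < - int n" for x
    proof -
      have "x = ?e (nat (-x - 1))" using n[of "nat (-x - 1)"] that by simp
      then show ?thesis unfolding beta_def by blast
    qed
    then show ?thesis by auto
  qed
  ultimately show ?thesis using charge_cut[OF maya_beta[OF assms], of "- int n"] by (metis add.commute add.right_inverse card.empty diff_zero of_nat_0)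
qed

section \<open>Rim hooks as bead moves\<close>

lemma young_diagram_Sigma: "young_diagram p = (SIGMA r:{r. p r \<noteq> 0}. {..<p r})"
  by (auto simp: young_diagram_def)

lemma finite_young_diagram: "is_partition p \<Longrightarrow> finite (young_diagram p)"
  by (simp add: young_diagram_Sigma is_partition_def)

lemma psize_eq_card: "is_partition p \<Longrightarrow> psize p = card (young_diagram p)"
  by (simp add: young_diagram_Sigma is_partition_def psize_def)

lemma young_diagram_subset_iff: "young_diagram q \<subseteq> young_diagram p \<longleftrightarrow> (\<forall>r. q r \<le> p r)"
proof
  assume s: "young_diagram q \<subseteq> young_diagram p"
  show "\<forall>r. q r \<le> p r"
  proof
    fix r show "q r \<le> p r"
    proof (rule ccontr)
      assume "\<not> ?thesis"
      then have "(r, p r) \<in> young_diagram q" by (simp add: young_diagram_def)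
      then show False using s by (auto simp: young_diagram_def)
    qed
  qed
next
  assume "\<forall>r. q r \<le> p r"
  then show "young_diagram q \<subseteq> young_diagram p"
    by (auto simp: young_diagram_def intro: less_le_trans)
qed

definition strip :: "(nat \<Rightarrow> nat) \<Rightarrow> (nat \<Rightarrow> nat) \<Rightarrow> nat \<Rightarrow> nat \<Rightarrow> bool" where
  "strip p q i j \<longleftrightarrow> i \<le> j \<and> (\<forall>r. r < i \<or> j < r \<longrightarrow> q r = p r) \<and>
     (\<forall>r. i \<le> r \<and> r < j \<longrightarrow> Suc (q r) = p (Suc r)) \<and> q j < p j"

lemma strip_less:
  assumes "is_partition p" "strip p q i j" "i \<le> r" "r \<le> j"
  shows "q r < p r"
proof (cases "r = j")
  case True then show ?thesis using assms(2) by (simp add: strip_def)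
next
  case False
  then have "Suc (q r) = p (Suc r)" using assms by (simp add: strip_def)
  then show ?thesis using partition_antimono[OF assms(1), of r "Suc r"] by simp
qed

lemma strip_diff:
  assumes "is_partition p" "strip p q i j"
  shows "young_diagram p - young_diagram q = (SIGMA r:{i..j}. {q r..<p r})"
proof -
  have "r \<in> {i..j}" if "q r \<le> c" "c < p r" for r c
    using assms(2) that unfolding strip_def by (metis atLeastAtMost_iff not_less)
  then show ?thesis by (auto simp: young_diagram_def not_less)
qed

lemma strip_card:
  assumes "is_partition p" "strip p q i j"
  shows "int (card (young_diagram p - young_diagram q)) = int (p i) - int i - (int (q j) - int j)"
proof -
  have ij: "i \<le> j" using assms(2) by (simp add: strip_def)
  have "card (young_diagram p - young_diagram q) = (\<Sum>r\<in>{i..j}. p r - q r)"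
    unfolding strip_diff[OF assms] by simp
  also have "int \<dots> = (\<Sum>r\<in>{i..j}. int (p r) - int (q r))"
    unfolding of_nat_sum
  proof (rule sum.cong)
    fix r assume "r \<in> {i..j}"
    then show "int (p r - q r) = int (p r) - int (q r)" using strip_less[OF assms, of r] by simp
  qed simp
  also have "\<dots> = (\<Sum>r\<in>{i..j}. int (p r)) - (\<Sum>r\<in>{i..j}. int (q r))" by (rule sum_subtractf)
  also have "(\<Sum>r\<in>{i..j}. int (q r)) = (\<Sum>r\<in>{i..<j}. int (q r)) + int (q j)"
    using ij by (metis atLeastLessThanSuc_atLeastAtMost sum.atLeastLessThan_Suc)
  also have "(\<Sum>r\<in>{i..j}. int (p r)) = int (p i) + (\<Sum>r\<in>{i..<j}. int (p (Suc r)))"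
    using sum.atLeast_Suc_atMost[OF ij, of "\<lambda>r. int (p r)"] sum.shift_bounds_Suc_ivl[of "\<lambda>r. int (p r)" i j]
    by (simp only: atLeastLessThanSuc_atLeastAtMost)
  also have "(\<Sum>r\<in>{i..<j}. int (p (Suc r))) = (\<Sum>r\<in>{i..<j}. int (q r) + 1)"
  proof (rule sum.cong)
    fix r assume "r \<in> {i..<j}"
    then have "Suc (q r) = p (Suc r)" using assms(2) by (simp add: strip_def)
    then show "int (p (Suc r)) = int (q r) + 1" by linarith
  qed simp
  also have "\<dots> = (\<Sum>r\<in>{i..<j}. int (q r)) + (int j - int i)" using ij by (simp add: sum.distrib of_nat_diff)
  finally show ?thesis by simp
qed

lemma strip_beta:
  assumes "is_partition p" "is_partition q" "strip p q i j"
  defines "e \<equiv> int (p i) - int i - 1" and "f \<equiv> int (q j) - int j - 1"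
  shows "e \<in> beta p" "f \<notin> beta p" "beta q = insert f (beta p - {e})"
proof -
  let ?p = "\<lambda>r. int (p r) - int r - 1" and ?q = "\<lambda>r. int (q r) - int r - 1"
  have ij: "i \<le> j" and out: "\<And>r. r < i \<or> j < r \<Longrightarrow> q r = p r"
    and inn: "\<And>r. i \<le> r \<Longrightarrow> r < j \<Longrightarrow> Suc (q r) = p (Suc r)" and lt: "q j < p j"
    using assms(3) by (auto simp: strip_def)
  show e: "e \<in> beta p" by (simp add: e_def beta_def)
  have low: "?p r < f" if "j < r" for r
    using beta_strict[OF assms(2) that] out[of r] that by (simp add: f_def)
  have high: "f < ?p r" if "r \<le> j" for r
    using partition_antimono[OF assms(1) that] lt that by (simp add: f_def)
  show f: "f \<notin> beta p"
  proof
    assume "f \<in> beta p"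
    then obtain r where "f = ?p r" by (auto simp: beta_def)
    then show False using low[of r] high[of r] by (cases "r \<le> j") auto
  qed
  have shift: "?q r = ?p (Suc r)" if "i \<le> r" "r < j" for r using inn[OF that] by linarith
  have ne: "?p r \<noteq> e" if "r \<noteq> i" for r using beta_index_inj[OF assms(1), of r i] that by (auto simp: e_def)
  show "beta q = insert f (beta p - {e})"
  proof
    show "beta q \<subseteq> insert f (beta p - {e})"
    proof
      fix x assume "x \<in> beta q"
      then obtain r where r: "x = ?q r" by (auto simp: beta_def)
      consider "r = j" | "r < i \<or> j < r" | "i \<le> r" "r < j" by linarith
      then show "x \<in> insert f (beta p - {e})"
      proof cases
        case 1 then show ?thesis using r by (simp add: f_def)
      next
        case 2
        then have "x = ?p r" "r \<noteq> i" using r out ij by auto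
        then show ?thesis using ne unfolding beta_def by auto
      next
        case 3
        then have "x = ?p (Suc r)" "Suc r \<noteq> i" using r shift by auto
        then show ?thesis using ne unfolding beta_def by blast
      qed
    qed
    show "insert f (beta p - {e}) \<subseteq> beta q"
    proof
      fix x assume x: "x \<in> insert f (beta p - {e})"
      show "x \<in> beta q"
      proof (cases "x = f")
        case True then show ?thesis by (simp add: f_def beta_def)
      next
        case False
        then obtain r where r: "x = ?p r" "x \<noteq> e" using x by (auto simp: beta_def)
        then have "r \<noteq> i" by (auto simp: e_def)
        then consider "r < i \<or> j < r" | r' where "r = Suc r'" "i \<le> r'" "r' < j"
          by (metis Suc_le_eq less_Suc_eq_le not_less not_less_eq_eq lessE linorder_neqE_nat le_eq_less_or_eq Suc_lessD)
        then show ?thesis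
        proof cases
          case 1
          then have "x = ?q r" using r out by auto
          then show ?thesis unfolding beta_def by blast
        next
          case 2
          then have "x = ?q r'" using r shift by auto
          then show ?thesis unfolding beta_def by blast
        qed
      qed
    qed
  qed
qed

lemma connected_crossing:
  assumes "(\<lambda>a b. a \<in> H \<and> b \<in> H \<and> adjacent_nodes a b)\<^sup>*\<^sup>* x y" "fst x \<le> r" "r < fst y"
  shows "\<exists>c. (r, c) \<in> H \<and> (Suc r, c) \<in> H"
  using assms
proof (induction rule: rtranclp_induct)
  case base then show ?case by simp
next
  case (step y z)
  show ?case
  proof (cases "r < fst y")
    case True then show ?thesis using step by blast
  next
    case False
    then have "fst y = r" "fst z = Suc r" "snd y = snd z"
      using step by (auto simp: adjacent_nodes_def)
    then show ?thesis using step.hyps(2) by (metis prod.collapse)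
  qed
qed

lemma removes_hook_strip:
  assumes "is_partition p" "removes_hook d p q" "0 < d"
  obtains i j where "strip p q i j" "card (young_diagram p - young_diagram q) = d"
proof -
  obtain H where H: "H \<subseteq> rim p" "connected_nodes H" "card H = d" "young_diagram q = young_diagram p - H"
    and q: "is_partition q"
    using assms(2) by (auto simp: removes_hook_def rim_hook_def)
  have "H \<subseteq> young_diagram p" using H(1) by (auto simp: rim_def)
  then have Hd: "H = young_diagram p - young_diagram q" using H(4) by blast
  have le: "q r \<le> p r" for r using young_diagram_subset_iff[of q p] H(4) by blast
  have Hm: "(r, c) \<in> H \<longleftrightarrow> q r \<le> c \<and> c < p r" for r c
    unfolding Hd by (auto simp: young_diagram_def)
  have fin: "finite H" "H \<noteq> {}" using H(3) assms(3) by (auto intro: card_ge_0_finite)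
  let ?i = "Min (fst ` H)" and ?j = "Max (fst ` H)"
  have "?i \<in> fst ` H" "?j \<in> fst ` H" using fin by auto
  then obtain ci cj where c: "(?i, ci) \<in> H" "(?j, cj) \<in> H" by auto
  have bnd: "?i \<le> r \<and> r \<le> ?j" if "(r, c) \<in> H" for r c
    using that fin by (metis Max_ge Min_le finite_imageI fst_conv image_eqI)
  have out: "q r = p r" if "r < ?i \<or> ?j < r" for r
  proof (rule ccontr)
    assume "q r \<noteq> p r"
    then have "(r, q r) \<in> H" using le[of r] by (simp add: Hm)
    then show False using bnd that by fastforce
  qed
  have "Suc (q r) = p (Suc r)" if r: "?i \<le> r" "r < ?j" for r
  proof -
    have "(\<lambda>a b. a \<in> H \<and> b \<in> H \<and> adjacent_nodes a b)\<^sup>*\<^sup>* (?i, ci) (?j, cj)"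
      using H(2) c unfolding connected_nodes_def by blast
    then obtain k where k: "(r, k) \<in> H" "(Suc r, k) \<in> H" using connected_crossing[of H _ _ r] r by force
    then have "q r < p r" "q r < p (Suc r)" by (auto simp: Hm)
    then have "(r, q r) \<in> rim p" using H(1) by (auto simp: Hm)
    then have "p (Suc r) \<le> Suc (q r)" by (simp add: rim_def young_diagram_def)
    then show ?thesis using \<open>q r < p (Suc r)\<close> by simp
  qed
  moreover have "?i \<le> ?j" using bnd[OF c(1)] by simp
  moreover have "q ?j < p ?j" using c(2) by (auto simp: Hm)
  ultimately have "strip p q ?i ?j" using out unfolding strip_def by blast
  then show ?thesis using that H(3) Hd by blast
qed

lemma strip_removes_hook:
  assumes "is_partition p" "is_partition q" "strip p q i j"
  shows "removes_hook (card (young_diagram p - young_diagram q)) p q"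
proof -
  let ?H = "young_diagram p - young_diagram q"
  let ?R = "\<lambda>a b. a \<in> ?H \<and> b \<in> ?H \<and> adjacent_nodes a b"
  have Hm: "(r, c) \<in> ?H \<longleftrightarrow> i \<le> r \<and> r \<le> j \<and> q r \<le> c \<and> c < p r" for r c
    unfolding strip_diff[OF assms(1,3)] by auto
  have inn: "\<And>r. i \<le> r \<Longrightarrow> r < j \<Longrightarrow> Suc (q r) = p (Suc r)" using assms(3) by (auto simp: strip_def)
  have le: "q r \<le> p r" for r
    using strip_less[OF assms(1,3), of r] assms(3) unfolding strip_def by (metis less_imp_le not_less order_refl)
  have "?H \<subseteq> rim p"
  proof clarify
    fix r c assume a: "(r, c) \<in> young_diagram p" "(r, c) \<notin> young_diagram q"
    then have h: "i \<le> r" "r \<le> j" "q r \<le> c" "c < p r" using Hm[of r c] by auto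
    have "p (Suc r) \<le> Suc c"
    proof (cases "r < j")
      case True then show ?thesis using inn[OF h(1)] h by simp
    next
      case False
      then have "q (Suc r) = p (Suc r)" using h assms(3) by (simp add: strip_def)
      then show ?thesis using partition_antimono[OF assms(2), of r "Suc r"] h by simp
    qed
    then show "(r, c) \<in> rim p" using a(1) by (simp add: rim_def young_diagram_def)
  qed
  moreover have "connected_nodes ?H"
  proof -
    have row: "?R\<^sup>*\<^sup>* (r, c) (r, c + k)" if "(r, c) \<in> ?H" "(r, c + k) \<in> ?H" for r c k
      using that
    proof (induction k)
      case 0 then show ?case by simp
    next
      case (Suc k)
      have k: "(r, c + k) \<in> ?H" using Suc.prems unfolding Hm by auto
      then have "?R (r, c + k) (r, c + Suc k)" using Suc.prems(2) by (simp add: adjacent_nodes_def)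
      with Suc.IH[OF Suc.prems(1) k] show ?case by (rule rtranclp.rtrancl_into_rtrancl)
    qed
    have top: "?R\<^sup>*\<^sup>* (i + k, c) (i, p i - 1)" if "(i + k, c) \<in> ?H" for k c
      using that
    proof (induction k arbitrary: c)
      case 0
      then have "(i, p i - 1) \<in> ?H" "p i - 1 = c + (p i - 1 - c)" unfolding Hm by auto
      then show ?case using row[of i c "p i - 1 - c"] 0 by simp
    next
      case (Suc k)
      let ?r = "i + Suc k"
      have h: "i \<le> ?r" "?r \<le> j" "q ?r \<le> c" "c < p ?r" using Suc.prems unfolding Hm by auto
      have e: "(?r, p ?r - 1) \<in> ?H" "p ?r - 1 = c + (p ?r - 1 - c)" using h unfolding Hm by auto
      have "Suc (q (i + k)) = p ?r" using inn[of "i + k"] h by simp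
      moreover have "p ?r \<le> p (i + k)" using partition_antimono[OF assms(1)] by simp
      ultimately have up: "(i + k, p ?r - 1) \<in> ?H" using h unfolding Hm by auto
      then have "?R (?r, p ?r - 1) (i + k, p ?r - 1)" using e(1) by (simp add: adjacent_nodes_def)
      from converse_rtranclp_into_rtranclp[of ?R, OF this Suc.IH[OF up]]
      have "?R\<^sup>*\<^sup>* (?r, p ?r - 1) (i, p i - 1)" .
      moreover have "?R\<^sup>*\<^sup>* (?r, c) (?r, p ?r - 1)"
        using row[OF Suc.prems, of "p ?r - 1 - c"] e by (simp only: e(2)[symmetric])
      ultimately show ?case by (rule rtranclp_trans[rotated])
    qed
    have top': "?R\<^sup>*\<^sup>* x (i, p i - 1)" if "x \<in> ?H" for x
    proof -
      obtain r c where x: "x = (r, c)" by fastforce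
      then have "r = i + (r - i)" using that Hm[of r c] by auto
      then show ?thesis using top[of "r - i" c] that x by simp
    qed
    have "symp ?R" by (auto simp: symp_def adjacent_nodes_def)
    then have sym: "symp ?R\<^sup>*\<^sup>*" by (rule symp_rtranclp)
    have "?R\<^sup>*\<^sup>* x y" if "x \<in> ?H" "y \<in> ?H" for x y
      by (rule rtranclp_trans[OF top'[OF that(1)] sympD[OF sym top'[OF that(2)]]])
    then show ?thesis unfolding connected_nodes_def by blast
  qed
  moreover have "young_diagram q = young_diagram p - ?H"
    using le young_diagram_subset_iff[of q p] by blast
  ultimately show ?thesis using assms(2) unfolding removes_hook_def rim_hook_def by blast
qed

lemma bead_move_strip:
  assumes "is_partition p" "x \<in> beta p" "x - int d \<notin> beta p" "0 < d"
  obtains q i j where "is_partition q" "strip p q i j" "x = int (p i) - int i - 1" "x - int d = int (q j) - int j - 1"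
proof -
  let ?e = "\<lambda>r. int (p r) - int r - 1" and ?y = "x - int d"
  obtain i where i: "x = ?e i" using assms(2) by (auto simp: beta_def)
  have sub: "{r. ?y < ?e r} \<subseteq> {..< nat (int (p 0) - ?y)}"
  proof
    fix r assume "r \<in> {r. ?y < ?e r}"
    then show "r \<in> {..< nat (int (p 0) - ?y)}" using partition_antimono[OF assms(1), of 0 r] by auto
  qed
  then have fin: "finite {r. ?y < ?e r}" by (rule finite_subset) simp
  define j where "j = Max {r. ?y < ?e r}"
  have iin: "i \<in> {r. ?y < ?e r}" using i assms(4) by simp
  then have ij: "i \<le> j" unfolding j_def using fin by (intro Max_ge)
  have "j \<in> {r. ?y < ?e r}" unfolding j_def using fin iin by (intro Max_in) auto
  then have j: "?y < ?e j" by simp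
  have "Suc j \<notin> {r. ?y < ?e r}" using Max_ge[OF fin, of "Suc j"] unfolding j_def by auto
  moreover have "?e (Suc j) \<in> beta p" unfolding beta_def by (rule rangeI)
  then have "?e (Suc j) \<noteq> ?y" using assms(3) by metis
  ultimately have j': "?e (Suc j) < ?y" by simp
  define q where "q r = (if i \<le> r \<and> r < j then p (Suc r) - 1 else if r = j then nat (?y + int j + 1) else p r)" for r
  have qj: "int (q j) = ?y + int j + 1" using j' by (simp add: q_def)
  have pj: "0 < p r" if "r \<le> j" for r
    using partition_antimono[OF assms(1) that] qj j by linarith
  have "q (Suc k) \<le> q k" for k
  proof -
    have a: "p (Suc k) \<le> p k" "p (Suc (Suc k)) \<le> p (Suc k)" using partition_antimono[OF assms(1)] by auto
    have b: "q j \<le> p j - 1" "p (Suc j) \<le> q j" using j j' qj by linarith+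
    consider "k > j" | "k = j" | "Suc k = j" | "Suc k < j" by linarith
    then show ?thesis
    proof cases
      case 1 then show ?thesis using a by (simp add: q_def)
    next
      case 2 then show ?thesis using b ij by (simp add: q_def)
    next
      case 3
      then show ?thesis using a b ij by (auto simp: q_def split: if_splits)
    next
      case 4
      then show ?thesis using a by (auto simp: q_def split: if_splits)
    qed
  qed
  then have "antimono q" by (simp add: antimono_iff_le_Suc)
  moreover have "{r. q r \<noteq> 0} \<subseteq> {..j} \<union> {r. p r \<noteq> 0}" by (auto simp: q_def)
  then have "finite {r. q r \<noteq> 0}" using assms(1) unfolding is_partition_def by (meson finite_UnI finite_atMost finite_subset)
  ultimately have "is_partition q" by (simp add: is_partition_def)
  moreover have "strip p q i j"
    unfolding strip_def
  proof (intro conjI allI impI)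
    show "i \<le> j" by (rule ij)
    show "q j < p j" using qj j by linarith
    show "q r = p r" if "r < i \<or> j < r" for r using that ij by (auto simp: q_def)
    show "Suc (q r) = p (Suc r)" if "i \<le> r \<and> r < j" for r
      using that pj[of "Suc r"] by (simp add: q_def)
  qed
  moreover have "?y = int (q j) - int j - 1" using qj by simp
  ultimately show ?thesis using that i by blast
qed

lemma removes_hook_iff:
  assumes "is_partition p" "0 < d"
  shows "removes_hook d p q \<longleftrightarrow> is_partition q \<and>
    (\<exists>x\<in>beta p. x - int d \<notin> beta p \<and> beta q = insert (x - int d) (beta p - {x}))"
proof
  assume r: "removes_hook d p q"
  then have q: "is_partition q" unfolding removes_hook_def by blast
  obtain i j where ij: "strip p q i j" "card (young_diagram p - young_diagram q) = d"
    using removes_hook_strip[OF assms(1) r assms(2)] by metis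
  have "int (q j) - int j - 1 = (int (p i) - int i - 1) - int d"
    using strip_card[OF assms(1) ij(1)] ij(2) by simp
  then show "is_partition q \<and> (\<exists>x\<in>beta p. x - int d \<notin> beta p \<and> beta q = insert (x - int d) (beta p - {x}))"
    using strip_beta[OF assms(1) q ij(1)] q by metis
next
  assume r: "is_partition q \<and> (\<exists>x\<in>beta p. x - int d \<notin> beta p \<and> beta q = insert (x - int d) (beta p - {x}))"
  then obtain x where x: "x \<in> beta p" "x - int d \<notin> beta p" "beta q = insert (x - int d) (beta p - {x})" by blast
  obtain q' i j where q': "is_partition q'" "strip p q' i j" "x = int (p i) - int i - 1" "x - int d = int (q' j) - int j - 1"
    using bead_move_strip[OF assms(1) x(1,2) assms(2)] by metis
  have "beta q' = beta q" using strip_beta(3)[OF assms(1) q'(1,2)] x(3) q'(3,4) by metis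
  then have "q' = q" using beta_inj q'(1) r by blast
  moreover have "card (young_diagram p - young_diagram q') = d"
    using strip_card[OF assms(1) q'(2)] q'(3,4) by simp
  ultimately show "removes_hook d p q" using strip_removes_hook[OF assms(1) q'(1,2)] by simp
qed

section \<open>Cores and weights\<close>

lemma removes_hook_psize:
  assumes "is_partition p" "0 < d" "removes_hook d p q"
  shows "psize p = psize q + d"
proof -
  obtain i j where h: "strip p q i j" "card (young_diagram p - young_diagram q) = d"
    using removes_hook_strip[OF assms(1,3,2)] by metis
  have q: "is_partition q" and sub: "young_diagram q \<subseteq> young_diagram p"
    using assms(3) unfolding removes_hook_def by blast+
  have "card (young_diagram p - young_diagram q) = card (young_diagram p) - card (young_diagram q)"
    using card_Diff_subset finite_young_diagram[OF q] sub by blast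
  moreover have "card (young_diagram q) \<le> card (young_diagram p)"
    using card_mono finite_young_diagram[OF assms(1)] sub by blast
  ultimately show ?thesis using h(2) psize_eq_card assms(1) q by simp
qed

lemma removes_hook_rcharge:
  assumes "is_partition p" "0 < d" "removes_hook d p q"
  shows "rcharge (int d) (beta q) = rcharge (int d) (beta p)"
proof -
  obtain x where x: "x \<in> beta p" "x - int d \<notin> beta p" "beta q = insert (x - int d) (beta p - {x})"
    using removes_hook_iff[OF assms(1,2)] assms(3) by blast
  show ?thesis
    unfolding x(3) by (rule rcharge_move_runner[OF maya_beta[OF assms(1)] _ x(1,2)]) (use assms(2) in auto)
qed

lemma removes_hook_inversions:
  assumes "is_partition p" "0 < d" "removes_hook d p q"
  shows "card (inversions (int d) (beta p)) = Suc (card (inversions (int d) (beta q)))"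
proof -
  obtain x where x: "x \<in> beta p" "x - int d \<notin> beta p" "beta q = insert (x - int d) (beta p - {x})"
    using removes_hook_iff[OF assms(1,2)] assms(3) by blast
  show ?thesis
    unfolding x(3) by (rule card_inversions_move[OF maya_beta[OF assms(1)] _ x(1,2)]) (use assms(2) in auto)
qed

lemma is_core_iff:
  assumes "0 < d"
  shows "is_core d p \<longleftrightarrow> is_partition p \<and> bead_core (int d) (beta p)"
proof (cases "is_partition p")
  case True
  have "(\<exists>H. rim_hook d p H) \<longleftrightarrow> (\<exists>q. removes_hook d p q)"
    unfolding removes_hook_def rim_hook_def by blast
  also have "\<dots> \<longleftrightarrow> (\<exists>x\<in>beta p. x - int d \<notin> beta p)"
  proof
    assume "\<exists>x\<in>beta p. x - int d \<notin> beta p"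
    then obtain x where x: "x \<in> beta p" "x - int d \<notin> beta p" by blast
    let ?B = "insert (x - int d) (beta p - {x})"
    have "maya ?B" "charge ?B = 0"
      using maya_move charge_move[OF _ x] maya_beta[OF True] charge_beta[OF True] by auto
    then obtain q where "is_partition q" "beta q = ?B" using beta_surj by metis
    then show "\<exists>q. removes_hook d p q" using removes_hook_iff[OF True assms] x by blast
  qed (use removes_hook_iff[OF True assms] in blast)
  finally show ?thesis using True unfolding is_core_def bead_core_def by blast
qed (simp add: is_core_def)

lemma removes_hook_pow:
  assumes "is_partition p" "0 < d" "(removes_hook d ^^ w) p q"
  shows "is_partition q \<and> psize p = psize q + w * d
    \<and> rcharge (int d) (beta q) = rcharge (int d) (beta p)
    \<and> card (inversions (int d) (beta p)) = card (inversions (int d) (beta q)) + w"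
  using assms(3)
proof (induction w arbitrary: q)
  case 0 then show ?case using assms(1) by simp
next
  case (Suc w)
  then obtain r where r: "(removes_hook d ^^ w) p r" "removes_hook d r q" by auto
  have IH: "is_partition r" "psize p = psize r + w * d"
    "rcharge (int d) (beta r) = rcharge (int d) (beta p)"
    "card (inversions (int d) (beta p)) = card (inversions (int d) (beta r)) + w"
    using Suc.IH[OF r(1)] by auto
  have "is_partition q" using r(2) unfolding removes_hook_def by blast
  then show ?case
    using IH removes_hook_psize[OF IH(1) assms(2) r(2)] removes_hook_rcharge[OF IH(1) assms(2) r(2)]
      removes_hook_inversions[OF IH(1) assms(2) r(2)] by simp
qed

lemma core_reachable:
  assumes "is_partition p" "0 < d"
  shows "\<exists>w q. (removes_hook d ^^ w) p q \<and> is_core d q"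
  using assms(1)
proof (induction "psize p" arbitrary: p rule: less_induct)
  case less
  show ?case
  proof (cases "is_core d p")
    case True
    then have "(removes_hook d ^^ 0) p p \<and> is_core d p" by simp
    then show ?thesis by blast
  next
    case False
    then obtain q where q: "removes_hook d p q" "is_partition q"
      using less.prems unfolding is_core_def removes_hook_def rim_hook_def by blast
    then have "psize q < psize p" using removes_hook_psize[OF less.prems assms(2)] assms(2) by simp
    then obtain w r where "(removes_hook d ^^ w) q r" "is_core d r" using less.hyps q(2) by blast
    then have "(removes_hook d ^^ Suc w) p r \<and> is_core d r" using q(1) relpowp_Suc_I2 by metis
    then show ?thesis by blast
  qed
qed

lemma core_unique:
  assumes "0 < d" "is_core d q" "is_core d r" "rcharge (int d) (beta q) = rcharge (int d) (beta r)"
  shows "q = r"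
proof -
  have q: "is_partition q" "bead_core (int d) (beta q)" and r: "is_partition r" "bead_core (int d) (beta r)"
    using assms is_core_iff by auto
  have "beta q = beta r"
    using bead_core_iff[OF maya_beta[OF q(1)] _ q(2)] bead_core_iff[OF maya_beta[OF r(1)] _ r(2)] assms(1,4) by auto
  then show ?thesis using beta_inj q(1) r(1) by blast
qed

lemma cor_wei:
  assumes "is_partition p" "0 < d"
  shows is_core_cor: "is_core d (cor d p)"
    and rcharge_cor: "rcharge (int d) (beta (cor d p)) = rcharge (int d) (beta p)"
    and psize_cor_wei: "psize p = psize (cor d p) + d * wei d p"
    and wei_eq_inversions: "wei d p = card (inversions (int d) (beta p))"
proof -
  obtain w q where wq: "(removes_hook d ^^ w) p q" "is_core d q" using core_reachable[OF assms] by blast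
  note pw = removes_hook_pow[OF assms]
  have w: "card (inversions (int d) (beta p)) = w'" if "(removes_hook d ^^ w') p q'" "is_core d q'" for w' q'
    using pw[OF that(1)] inversions_bead_core[of "int d" "beta q'"] that(2) is_core_iff[OF assms(2)] assms(2) by simp
  have "cor d p = q"
    unfolding cor_def
  proof (rule the_equality)
    show "(removes_hook d)\<^sup>*\<^sup>* p q \<and> is_core d q" using wq relpowp_imp_rtranclp by metis
  next
    fix q' assume "(removes_hook d)\<^sup>*\<^sup>* p q' \<and> is_core d q'"
    then obtain w' where "(removes_hook d ^^ w') p q'" "is_core d q'" using rtranclp_imp_relpowp by metis
    then show "q' = q" using core_unique[OF assms(2), of q' q] pw wq by metis
  qed
  moreover have "wei d p = w"
    unfolding wei_def by (rule the_equality) (use wq w in blast)+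
  ultimately show "is_core d (cor d p)" "rcharge (int d) (beta (cor d p)) = rcharge (int d) (beta p)"
    "psize p = psize (cor d p) + d * wei d p" "wei d p = card (inversions (int d) (beta p))"
    using pw[OF wq(1)] w[OF wq] wq(2) by (simp_all add: mult.commute)
qed

lemma cor_eq_iff:
  assumes "is_partition p" "0 < d" "is_core d q"
  shows "cor d p = q \<longleftrightarrow> rcharge (int d) (beta p) = rcharge (int d) (beta q)"
  using core_unique[OF assms(2) is_core_cor[OF assms(1,2)] assms(3)] rcharge_cor[OF assms(1,2)] by metis

lemma beta_cor_iff:
  assumes "is_partition p" "0 < d"
  shows "x \<in> beta (cor d p) \<longleftrightarrow> 0 < rcharge (int d) (beta p) x"
proof -
  have "is_partition (cor d p)" "bead_core (int d) (beta (cor d p))"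
    using is_core_cor[OF assms] is_core_iff[OF assms(2)] by auto
  then show ?thesis using bead_core_iff[OF maya_beta, of "cor d p" "int d"] assms rcharge_cor by simp
qed

section \<open>Partitions with given cores\<close>

lemma psize_move:
  assumes "is_partition p" "is_partition q" "x \<in> beta p" "y \<notin> beta p" "beta q = insert y (beta p - {x})"
  shows "int (psize q) = int (psize p) + y - x"
proof (cases "y < x")
  case True
  define d where "d = nat (x - y)"
  have d: "0 < d" "x - int d = y" using True by (simp_all add: d_def)
  have "removes_hook d p q" using removes_hook_iff[OF assms(1) d(1)] assms d(2) by metis
  then show ?thesis using removes_hook_psize[OF assms(1) d(1)] d(2) by fastforce
next
  case False
  define d where "d = nat (y - x)"
  have "x \<noteq> y" using assms(3,4) by blast
  then have d: "0 < d" "y - int d = x" using False by (simp_all add: d_def)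
  have "y \<in> beta q" "x \<notin> beta q" "beta p = insert x (beta q - {y})"
    using assms(3-5) \<open>x \<noteq> y\<close> by auto
  then have "removes_hook d q p" using removes_hook_iff[OF assms(2) d(1)] assms(1) d(2) by metis
  then show ?thesis using removes_hook_psize[OF assms(2) d(1)] d(2) by fastforce
qed

lemma rcharge_double_move:
  assumes "maya B" "0 < d" "x \<in> B" "c \<in> B" "x \<noteq> c" "a \<notin> B" "b \<notin> B" "a \<noteq> b"
    and "d dvd a - x \<and> d dvd b - c \<or> d dvd b - x \<and> d dvd a - c"
  shows "rcharge d (insert b (insert a (B - {x}) - {c})) = rcharge d B"
proof -
  have *: "rcharge d (insert b (insert a (B - {x}) - {c})) = rcharge d B"
    if h: "a \<notin> B" "b \<notin> B" "a \<noteq> b" "d dvd a - x" "d dvd b - c" for a b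
  proof -
    have "c \<in> insert a (B - {x})" "b \<notin> insert a (B - {x})" using assms h by auto
    then show ?thesis
      using rcharge_move_runner[OF maya_move[OF assms(1)] assms(2) _ _ h(5)]
        rcharge_move_runner[OF assms(1-3) h(1,4)] by metis
  qed
  have e: "insert b (insert a (B - {x}) - {c}) = insert a (insert b (B - {x}) - {c})"
    using assms by auto
  show ?thesis using assms(9) *[of a b] *[of b a] e assms(6-8) by metis
qed

lemma double_move_partition:
  assumes "is_partition p" "x \<in> beta p" "c \<in> beta p" "x \<noteq> c" "a \<notin> beta p" "b \<notin> beta p" "a \<noteq> b" "a + b = x + c"
  obtains q where "is_partition q" "q \<noteq> p" "psize q = psize p"
    "beta q = insert b (insert a (beta p - {x}) - {c})"
proof -
  let ?B = "insert a (beta p - {x})"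
  have B: "maya ?B" "charge ?B = 0"
    using maya_move[OF maya_beta] charge_move[OF maya_beta, of p x a] charge_beta assms by auto
  have c: "c \<in> ?B" "b \<notin> ?B" using assms by auto
  have C: "maya (insert b (?B - {c}))" "charge (insert b (?B - {c})) = 0"
    using maya_move[OF B(1)] charge_move[OF B(1) c] B(2) by auto
  obtain r where r: "is_partition r" "beta r = ?B" using beta_surj[OF B] by metis
  obtain q where q: "is_partition q" "beta q = insert b (?B - {c})" using beta_surj[OF C] by metis
  have "int (psize r) = int (psize p) + a - x" using psize_move[OF assms(1) r(1)] assms r by blast
  moreover have "int (psize q) = int (psize r) + b - c" using psize_move[OF r(1) q(1)] c q r by metis
  ultimately have "psize q = psize p" using assms(8) by linarith
  moreover have "b \<in> beta q" using q(2) by simp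
  then have "q \<noteq> p" using assms(6) by metis
  ultimately show ?thesis using that q by blast
qed

lemma frontier:
  assumes "maya B" "0 < e"
  obtains n where "w + n * e \<in> B" "w + n * e + e \<notin> B"
proof -
  let ?R = "runner e B w"
  obtain N where N: "0 \<le> N" "{..<-N} \<subseteq> ?R" "?R \<subseteq> {..<N}" using maya_bounds[OF maya_runner[OF assms]] by metis
  let ?X = "?R \<inter> {-N-1..N}"
  have fin: "finite ?X" by simp
  moreover have "-N-1 \<in> ?X" using N(1,2) by auto
  ultimately have m: "Max ?X \<in> ?X" using Max_in by blast
  have "Max ?X + 1 \<notin> ?R"
  proof
    assume a: "Max ?X + 1 \<in> ?R"
    then have "Max ?X + 1 < N" using N(3) by blast
    then have "Max ?X + 1 \<in> ?X" using a m by simp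
    then show False using Max_ge[OF fin] by fastforce
  qed
  then have "w + Max ?X * e + e \<notin> B" by (simp add: runner_def algebra_simps)
  moreover have "w + Max ?X * e \<in> B" using m by (simp add: runner_def)
  ultimately show ?thesis using that by blast
qed

text \<open>Exchanging the two beads of a checkerboard pattern with its two gaps preserves everything. If the
  pattern is degenerate (two of its corners coincide), there is a bead \<open>y\<close> and a gap \<open>y - e\<close> with
  \<open>s t\<close> dividing \<open>e\<close>; its slide is compensated on another residue class modulo \<open>s t\<close>.\<close>

lemma not_nested_second_partition:
  fixes s t :: int
  assumes "1 < s" "1 < t" "coprime s t" "is_partition p" "\<not> nested s t (beta p)"
  obtains q where "is_partition q" "q \<noteq> p" "psize q = psize p"
    "rcharge s (beta q) = rcharge s (beta p)" "rcharge t (beta q) = rcharge t (beta p)"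
proof -
  let ?B = "beta p"
  have m: "maya ?B" using maya_beta assms(4) .
  note result = that
  have swap: thesis if h: "x \<in> ?B" "c \<in> ?B" "x \<noteq> c" "a \<notin> ?B" "b \<notin> ?B" "a \<noteq> b" "a + b = x + c"
    "\<And>d. d = s \<or> d = t \<Longrightarrow> d dvd a - x \<and> d dvd b - c \<or> d dvd b - x \<and> d dvd a - c" for x a b c
  proof -
    obtain q where q: "is_partition q" "q \<noteq> p" "psize q = psize p" "beta q = insert b (insert a (?B - {x}) - {c})"
      using double_move_partition[OF assms(4) h(1-7)] by metis
    have "rcharge d (beta q) = rcharge d ?B" if "d = s \<or> d = t" for d
      unfolding q(4) by (rule rcharge_double_move[OF m _ h(1-6) h(8)[OF that]]) (use that assms in auto)
    then show thesis using result q by blast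
  qed
  obtain x i k where x: "x \<in> ?B" "x + i * s \<notin> ?B" "x + k * t \<notin> ?B" "x + i * s + k * t \<in> ?B"
    using assms(5) unfolding nested_def by blast
  show thesis
  proof (cases "i * s \<noteq> k * t \<and> i * s + k * t \<noteq> 0")
    case True
    show thesis
    proof (rule swap[OF x(1,4) _ x(2,3)])
      show "d dvd x + i * s - x \<and> d dvd x + k * t - (x + i * s + k * t)
          \<or> d dvd x + k * t - x \<and> d dvd x + i * s - (x + i * s + k * t)" if "d = s \<or> d = t" for d
        using that by auto
    qed (use True in auto)
  next
    case False
    have "\<exists>y e. y \<in> ?B \<and> y - e \<notin> ?B \<and> 0 < e \<and> s dvd e \<and> t dvd e"
    proof -
      define f where "f = i * s"
      have f: "s dvd f" "f \<noteq> 0" "x + f \<notin> ?B" using x by (auto simp: f_def)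
      have kt: "k * t = f \<or> k * t = - f" using False unfolding f_def by linarith
      have tf: "t dvd f" using kt by (metis dvd_minus_iff dvd_triv_right)
      have or: "x - f \<notin> ?B \<or> x + f + f \<in> ?B" using kt x(3,4) unfolding f_def[symmetric] by auto
      consider "f < 0" | "0 < f" "x - f \<notin> ?B" | "0 < f" "x + f + f \<in> ?B" using f(2) or by linarith
      then show ?thesis
      proof cases
        case 1
        then show ?thesis using f tf x(1) by (intro exI[of _ x] exI[of _ "- f"]) simp
      next
        case 2
        then show ?thesis using f tf x(1) by (intro exI[of _ x] exI[of _ f]) simp
      next
        case 3
        moreover have "x + f + f - f \<notin> ?B" using f(3) by (simp add: add.commute)
        ultimately show ?thesis using f(1) tf by blast
      qed
    qed
    then obtain y e where y: "y \<in> ?B" "y - e \<notin> ?B" "0 < e" "s dvd e" "t dvd e" by blast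
    obtain n where n: "y + 1 + n * e \<in> ?B" "y + 1 + n * e + e \<notin> ?B" using frontier[OF m y(3)] by metis
    have "\<not> s dvd 1" using assms(1) by (simp add: zdvd1_eq)
    then have ne: "1 + j * e \<noteq> 0" for j
      using y(4) by (metis add.commute add_eq_0_iff dvd_minus_iff dvd_mult)
    show thesis
    proof (rule swap[OF y(1) n(1) _ y(2) n(2)])
      show "y \<noteq> y + 1 + n * e" using ne[of n] by simp
      show "y - e \<noteq> y + 1 + n * e + e" using ne[of "n + 2"] by (simp add: algebra_simps)
      show "d dvd y - e - y \<and> d dvd y + 1 + n * e + e - (y + 1 + n * e)
          \<or> d dvd y + 1 + n * e + e - y \<and> d dvd y - e - (y + 1 + n * e)" if "d = s \<or> d = t" for d
        using that y(4,5) by auto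
    qed simp
  qed
qed

lemma core_partitions_iff:
  assumes "0 < s" "0 < t" "is_core s \<sigma>" "is_core t \<tau>"
  shows "p \<in> core_partitions s t \<sigma> \<tau> n \<longleftrightarrow> is_partition p \<and> psize p = n \<and>
    rcharge (int s) (beta p) = rcharge (int s) (beta \<sigma>) \<and> rcharge (int t) (beta p) = rcharge (int t) (beta \<tau>)"
  unfolding core_partitions_def using cor_eq_iff assms by auto

lemma core_partitions_commute: "core_partitions s t \<sigma> \<tau> n = core_partitions t s \<tau> \<sigma> n"
  by (auto simp: core_partitions_def)

context
  fixes s t :: nat and \<sigma> \<tau> :: "nat \<Rightarrow> nat"
  assumes s: "1 < s" and t: "1 < t" and cop: "coprime s t"
    and core_\<sigma>: "is_core s \<sigma>" and core_\<tau>: "is_core t \<tau>"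
begin

lemma partitions: "is_partition \<sigma>" "is_partition \<tau>"
  and bead_cores: "bead_core (int s) (beta \<sigma>)" "bead_core (int t) (beta \<tau>)"
  using core_\<sigma> core_\<tau> is_core_iff s t by auto

lemma mem_core_partitions:
  "p \<in> core_partitions s t \<sigma> \<tau> n \<longleftrightarrow> is_partition p \<and> psize p = n \<and>
    rcharge (int s) (beta p) = rcharge (int s) (beta \<sigma>) \<and> rcharge (int t) (beta p) = rcharge (int t) (beta \<tau>)"
  using core_partitions_iff s t core_\<sigma> core_\<tau> by simp

lemma core_partitions_size:
  assumes "p \<in> core_partitions s t \<sigma> \<tau> n"
  shows "n = psize \<tau> + t * wei t p"
  using assms psize_cor_wei[of p t] t by (auto simp: core_partitions_def)

lemma core_partitions_wei:
  assumes "p \<in> core_partitions s t \<sigma> \<tau> n"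
  shows "wei t \<sigma> \<le> wei t p" "wei t \<sigma> = wei t p \<longleftrightarrow> nested (int s) (int t) (beta p)"
proof -
  have p: "is_partition p" "rcharge (int s) (beta p) = rcharge (int s) (beta \<sigma>)"
    using assms mem_core_partitions by auto
  have st: "0 < int s" "0 < int t" using s t by auto
  note le = card_inversions_core_le[OF maya_beta[OF p(1)] maya_beta[OF partitions(1)] st bead_cores(1) p(2)]
  show "wei t \<sigma> \<le> wei t p" "wei t \<sigma> = wei t p \<longleftrightarrow> nested (int s) (int t) (beta p)"
    using le wei_eq_inversions p(1) partitions(1) t by auto
qed

lemma card_eq_1_iff_nested:
  "card (core_partitions s t \<sigma> \<tau> n) = 1 \<longleftrightarrow>
    (\<exists>p\<in>core_partitions s t \<sigma> \<tau> n. nested (int s) (int t) (beta p))" (is "?L \<longleftrightarrow> ?R")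
proof
  assume ?L
  then obtain p where P: "core_partitions s t \<sigma> \<tau> n = {p}" using card_1_singletonE by blast
  then have p: "p \<in> core_partitions s t \<sigma> \<tau> n" by simp
  have "nested (int s) (int t) (beta p)"
  proof (rule ccontr)
    assume nn: "\<not> nested (int s) (int t) (beta p)"
    have pp: "is_partition p" using p mem_core_partitions by blast
    obtain q where "is_partition q" "q \<noteq> p" "psize q = psize p"
      "rcharge (int s) (beta q) = rcharge (int s) (beta p)" "rcharge (int t) (beta q) = rcharge (int t) (beta p)"
      using not_nested_second_partition[OF _ _ _ pp nn] s t cop by auto
    then have "q \<in> core_partitions s t \<sigma> \<tau> n" using p by (simp add: mem_core_partitions)
    then show False using P \<open>q \<noteq> p\<close> by simp
  qed
  then show ?R using p by blast
next
  assume ?R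
  then obtain p where p: "p \<in> core_partitions s t \<sigma> \<tau> n" "nested (int s) (int t) (beta p)" by blast
  have "q = p" if q: "q \<in> core_partitions s t \<sigma> \<tau> n" for q
  proof -
    have "wei t q = wei t p" using core_partitions_size[OF q] core_partitions_size[OF p(1)] t by simp
    then have "nested (int s) (int t) (beta q)" using core_partitions_wei(2) p q by metis
    then have "beta q = beta p"
      using nested_unique[of "beta q" "beta p" "int s" "int t"] p q s t maya_beta by (simp add: mem_core_partitions)
    then show ?thesis using beta_inj p(1) q mem_core_partitions by metis
  qed
  then have "core_partitions s t \<sigma> \<tau> n = {p}" using p(1) by blast
  then show ?L by simp
qed

lemma cor_eq_iff_nested:
  "cor t \<sigma> = cor s \<tau> \<and> int n = int (psize \<sigma>) + int (psize \<tau>) - int (psize (cor t \<sigma>)) \<longleftrightarrow>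
    (\<exists>p\<in>core_partitions s t \<sigma> \<tau> n. nested (int s) (int t) (beta p))" (is "?L \<longleftrightarrow> ?R")
proof -
  have st: "0 < int s" "0 < int t" "0 < s" "0 < t" using s t by auto
  note m = maya_beta[OF partitions(1)] maya_beta[OF partitions(2)]
  have size: "int n = int (psize \<sigma>) + int (psize \<tau>) - int (psize (cor t \<sigma>))"
    if "p \<in> core_partitions s t \<sigma> \<tau> n" "nested (int s) (int t) (beta p)" for p n
    using core_partitions_wei(2)[OF that(1)] core_partitions_size[OF that(1)] that(2)
      psize_cor_wei[OF partitions(1) st(4)] by simp
  have mem: "y \<in> beta (cor t \<sigma>) \<longleftrightarrow> 0 < rcharge (int t) (beta \<sigma>) y"
    "y \<in> beta (cor s \<tau>) \<longleftrightarrow> 0 < rcharge (int s) (beta \<tau>) y" for y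
    using beta_cor_iff partitions st by auto
  show ?thesis
  proof
    assume L: ?L
    then have K: "0 < rcharge (int t) (beta \<sigma>) y \<longleftrightarrow> 0 < rcharge (int s) (beta \<tau>) y" for y
      using mem by metis
    obtain B where B: "maya B" "nested (int s) (int t) B" "rcharge (int s) B = rcharge (int s) (beta \<sigma>)"
      "rcharge (int t) B = rcharge (int t) (beta \<tau>)"
      using nested_exists[OF m st(1,2) bead_cores K] by metis
    have "charge B = 0" using rcharge_eq_charge_eq[OF B(1) m(1) st(1) B(3)] charge_beta partitions by simp
    then obtain p where p: "is_partition p" "beta p = B" using beta_surj B(1) by metis
    then have pm: "p \<in> core_partitions s t \<sigma> \<tau> (psize p)" using B by (simp add: mem_core_partitions)
    have "nested (int s) (int t) (beta p)" using B(2) p(2) by simp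
    from size[OF pm this] have "psize p = n" using L by linarith
    then show ?R using pm B(2) p(2) by blast
  next
    assume ?R
    then obtain p where p: "p \<in> core_partitions s t \<sigma> \<tau> n" "nested (int s) (int t) (beta p)" by blast
    then have pp: "is_partition p" "rcharge (int s) (beta p) = rcharge (int s) (beta \<sigma>)"
      "rcharge (int t) (beta p) = rcharge (int t) (beta \<tau>)" using mem_core_partitions by auto
    note mp = maya_beta[OF pp(1)]
    have "beta (cor t \<sigma>) = beta (cor s \<tau>)"
      using nested_core_core_pos[OF mp m st(1,2) p(2) bead_cores(1) pp(2) bead_cores(2) pp(3)]
        nested_core_core_pos[OF mp m(2,1) st(2,1) p(2)[unfolded nested_sym[of "int s"]] bead_cores(2) pp(3) bead_cores(1) pp(2)]
        mem by blast
    then have "cor t \<sigma> = cor s \<tau>"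
      using beta_inj is_core_cor[OF partitions(1) st(4)] is_core_cor[OF partitions(2) st(3)] is_core_def by metis
    then show ?L using size[OF p] by simp
  qed
qed

lemma core_partitions_nonempty: "\<exists>n. core_partitions s t \<sigma> \<tau> n \<noteq> {}"
proof -
  have st: "0 < int s" "0 < int t" "coprime (int s) (int t)" using s t cop by auto
  note m = maya_beta[OF partitions(1)] maya_beta[OF partitions(2)]
  obtain B where B: "maya B" "rcharge (int s) B = rcharge (int s) (beta \<sigma>)"
    "rcharge (int t) B = rcharge (int t) (beta \<tau>)"
    using common_charges_exist[OF m st] charge_beta partitions by metis
  have "charge B = 0" using rcharge_eq_charge_eq[OF B(1) m(1) st(1) B(2)] charge_beta partitions by simp
  then obtain p where "is_partition p" "beta p = B" using beta_surj B(1) by metis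
  then have "p \<in> core_partitions s t \<sigma> \<tau> (psize p)" using B by (simp add: mem_core_partitions)
  then show ?thesis by blast
qed

lemma min_size_iff_nested:
  "n = min_size s t \<sigma> \<tau> \<and> min_size s t \<sigma> \<tau> = psize \<tau> + t * wei t \<sigma> \<longleftrightarrow>
    (\<exists>p\<in>core_partitions s t \<sigma> \<tau> n. nested (int s) (int t) (beta p))" (is "?L \<longleftrightarrow> ?R")
proof
  assume L: ?L
  have "core_partitions s t \<sigma> \<tau> n \<noteq> {}"
    using L LeastI_ex[OF core_partitions_nonempty] unfolding min_size_def by simp
  then obtain p where p: "p \<in> core_partitions s t \<sigma> \<tau> n" by blast
  then have "wei t p = wei t \<sigma>" using core_partitions_size[OF p] L t by simp
  then show ?R using core_partitions_wei(2)[OF p] p by auto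
next
  assume ?R
  then obtain p where p: "p \<in> core_partitions s t \<sigma> \<tau> n" "nested (int s) (int t) (beta p)" by blast
  then have n: "n = psize \<tau> + t * wei t \<sigma>"
    using core_partitions_size[OF p(1)] core_partitions_wei(2)[OF p(1)] by simp
  have "min_size s t \<sigma> \<tau> = n"
    unfolding min_size_def
  proof (rule Least_equality)
    show "core_partitions s t \<sigma> \<tau> n \<noteq> {}" using p by blast
    fix k assume "core_partitions s t \<sigma> \<tau> k \<noteq> {}"
    then obtain q where q: "q \<in> core_partitions s t \<sigma> \<tau> k" by blast
    show "n \<le> k" using core_partitions_size[OF q] core_partitions_wei(1)[OF q] n by simp
  qed
  then show ?L using n by simp
qed

end

theorem theorem5p9:
  fixes s t n :: nat and \<sigma> \<tau> :: "nat \<Rightarrow> nat"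
  assumes "1 < s" and "1 < t" and "coprime s t"
    and "is_core s \<sigma>" and "is_core t \<tau>"
  shows "(card (core_partitions s t \<sigma> \<tau> n) = 1 \<longleftrightarrow>
            cor t \<sigma> = cor s \<tau> \<and>
            int n = int (psize \<sigma>) + int (psize \<tau>) - int (psize (cor t \<sigma>)))
       \<and> (card (core_partitions s t \<sigma> \<tau> n) = 1 \<longleftrightarrow>
            n = min_size s t \<sigma> \<tau> \<and> min_size s t \<sigma> \<tau> = psize \<tau> + t * wei t \<sigma>)
       \<and> (card (core_partitions s t \<sigma> \<tau> n) = 1 \<longleftrightarrow>
            n = min_size s t \<sigma> \<tau> \<and> min_size s t \<sigma> \<tau> = psize \<sigma> + s * wei s \<tau>)"
proof -
  have cop: "coprime t s" using assms(3) by (simp add: coprime_commute)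
  have "min_size t s \<tau> \<sigma> = min_size s t \<sigma> \<tau>"
    unfolding min_size_def core_partitions_commute[of t] ..
  then have "n = min_size s t \<sigma> \<tau> \<and> min_size s t \<sigma> \<tau> = psize \<sigma> + s * wei s \<tau> \<longleftrightarrow>
      (\<exists>p\<in>core_partitions s t \<sigma> \<tau> n. nested (int s) (int t) (beta p))"
    using min_size_iff_nested[OF assms(2,1) cop assms(5,4), of n]
    unfolding core_partitions_commute[of t] nested_sym[of "int t"] by simp
  then show ?thesis
    using card_eq_1_iff_nested[OF assms] cor_eq_iff_nested[OF assms] min_size_iff_nested[OF assms] by blast
qed

end
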